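(* For every integer $k\ge1$ and every $k$-part partition description $\Phi$, there exists a distance-approximation algorithm for the property $\mathcal{P}_\Phi$ with query complexity $\mathrm{poly}(k,1/\varepsilon)$.
   Context: A $k$-part partition description $\Phi$ consists of functions $s^{lb},s^{ub}:[k]\to[0,1]$ with $s^{lb}(i)\le s^{ub}(i)$ for all $i$, and symmetric functions $d^{lb},d^{ub}:[k]\times[k]\to[0,1]$ with $d^{lb}(i,j)\le d^{ub}(i,j)$ for all $i,j$. For a graph $G=(V,E)$ on $n$ vertices, a partition $(V_1,\dots,V_k)$ of $V$ satisfies $\Phi$ if $s^{lb}(i)n\le|V_i|\le s^{ub}(i)n$ for all $i\in[k]$ and $d^{lb}(i,j)n^2\le|E_G(V_i,V_j)|\le d^{ub}(i,j)n^2$ for all $i,j\in[k]$, where $E_G(V_i,V_j)$ is the set of edges of $G$ with one endpoint in $V_i$ and the other in $V_j$. $\mathcal{P}_\Phi$ is the set of graphs having a partition satisfying $\Phi$. $\Delta(G,G')=(|E\setminus E'|+|E'\setminus E|)/n^2$, $\Delta(G,\mathcal{P})=\min_{G'\in\mathcal{P}}\Delta(G,G')$. A distance-approximation algorithm for $\mathcal{P}$: for every $G$ and $\varepsilon\in(0,1)$, given $\varepsilon$ and adjacency-matrix query access, it outputs $\hat\Delta$ with $|\hat\Delta-\Delta(G,\mathcal{P})|\le\varepsilon$ with probability at least $2/3$; query complexity is the number of queries. *)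

theory Defs
  imports
    "HOL-Probability.Probability"
    "HOL-Computational_Algebra.Polynomial"
begin

text \<open>Simple undirected graphs on the vertex set \<open>{..<n}\<close>; an edge is a two-element set.\<close>

type_synonym edges = "nat set set"
type_synonym graph_property = "(nat \<times> edges) set"

definition graph :: "nat \<Rightarrow> edges \<Rightarrow> bool" where
  "graph n E \<longleftrightarrow> E \<subseteq> {{u, v} |u v. u < n \<and> v < n \<and> u \<noteq> v}"

text \<open>For \<open>A = B\<close> this is the set of edges inside \<open>A\<close>, each counted once.\<close>

definition edges_between :: "edges \<Rightarrow> nat set \<Rightarrow> nat set \<Rightarrow> edges" where
  "edges_between E A B = {e \<in> E. \<exists>u\<in>A. \<exists>v\<in>B. e = {u, v}}"

record partition_description =
  s_lb :: "nat \<Rightarrow> real"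
  s_ub :: "nat \<Rightarrow> real"
  d_lb :: "nat \<Rightarrow> nat \<Rightarrow> real"
  d_ub :: "nat \<Rightarrow> nat \<Rightarrow> real"

text \<open>The index set is \<open>{1..k}\<close>; the values of the four functions elsewhere are irrelevant.\<close>

definition valid_description :: "nat \<Rightarrow> partition_description \<Rightarrow> bool" where
  "valid_description k \<Phi> \<longleftrightarrow>
     (\<forall>i\<in>{1..k}. s_lb \<Phi> i \<in> {0..1} \<and> s_ub \<Phi> i \<in> {0..1} \<and> s_lb \<Phi> i \<le> s_ub \<Phi> i) \<and>
     (\<forall>i\<in>{1..k}. \<forall>j\<in>{1..k}.
        d_lb \<Phi> i j \<in> {0..1} \<and> d_ub \<Phi> i j \<in> {0..1} \<and> d_lb \<Phi> i j \<le> d_ub \<Phi> i j \<and>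
        d_lb \<Phi> i j = d_lb \<Phi> j i \<and> d_ub \<Phi> i j = d_ub \<Phi> j i)"

text \<open>Partitions are ordered, and parts may be empty.\<close>

definition vertex_partition :: "nat \<Rightarrow> nat \<Rightarrow> (nat \<Rightarrow> nat set) \<Rightarrow> bool" where
  "vertex_partition k n V \<longleftrightarrow> (\<Union>i\<in>{1..k}. V i) = {..<n} \<and> disjoint_family_on V {1..k}"

definition satisfies ::
    "nat \<Rightarrow> partition_description \<Rightarrow> nat \<Rightarrow> edges \<Rightarrow> (nat \<Rightarrow> nat set) \<Rightarrow> bool" where
  "satisfies k \<Phi> n E V \<longleftrightarrow>
     (\<forall>i\<in>{1..k}. s_lb \<Phi> i * real n \<le> real (card (V i)) \<and>
                  real (card (V i)) \<le> s_ub \<Phi> i * real n) \<and>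
     (\<forall>i\<in>{1..k}. \<forall>j\<in>{1..k}.
        d_lb \<Phi> i j * (real n)\<^sup>2 \<le> real (card (edges_between E (V i) (V j))) \<and>
        real (card (edges_between E (V i) (V j))) \<le> d_ub \<Phi> i j * (real n)\<^sup>2)"

definition partition_property :: "nat \<Rightarrow> partition_description \<Rightarrow> graph_property" where
  "partition_property k \<Phi> =
     {(n, E). graph n E \<and> (\<exists>V. vertex_partition k n V \<and> satisfies k \<Phi> n E V)}"

definition graph_dist :: "nat \<Rightarrow> edges \<Rightarrow> edges \<Rightarrow> real" where
  "graph_dist n E E' = (real (card (E - E')) + real (card (E' - E))) / (real n)\<^sup>2"

text \<open>
  There are only finitely many graphs on \<open>{..<n}\<close>, so the infimum is a minimum whenever some
  graph on \<open>n\<close> vertices has the property; otherwise the distance is \<open>\<infinity>\<close>.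
\<close>

definition dist_to_property :: "nat \<Rightarrow> edges \<Rightarrow> graph_property \<Rightarrow> ereal" where
  "dist_to_property n E P = Inf {ereal (graph_dist n E E') |E'. graph n E' \<and> (n, E') \<in> P}"

text \<open>
  A deterministic adaptive algorithm with access to the adjacency matrix is a decision tree:
  \<open>Query u v t0 t1\<close> asks for entry \<open>(u, v)\<close> and continues with \<open>t0\<close> if the pair is a non-edge
  and with \<open>t1\<close> if it is an edge.
\<close>

datatype decision_tree =
    Output ereal
  | Query nat nat decision_tree decision_tree

primrec run :: "edges \<Rightarrow> decision_tree \<Rightarrow> ereal" where
  "run E (Output r) = r"
| "run E (Query u v t0 t1) = (if {u, v} \<in> E then run E t1 else run E t0)"

primrec num_queries :: "edges \<Rightarrow> decision_tree \<Rightarrow> nat" where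
  "num_queries E (Output r) = 0"
| "num_queries E (Query u v t0 t1) =
     Suc (if {u, v} \<in> E then num_queries E t1 else num_queries E t0)"

text \<open>
  A randomized algorithm receives \<open>n\<close> and \<open>\<epsilon>\<close>, and its internal randomness selects a
  decision tree. Only queries are charged for, so no computability is imposed.
\<close>

type_synonym query_algorithm = "nat \<Rightarrow> real \<Rightarrow> decision_tree pmf"

text \<open>
  The two-sided inequality is \<open>\<bar>r - \<Delta>\<bar> \<le> \<epsilon>\<close> for finite distance \<open>\<Delta>\<close>, and forces
  \<open>r = \<infinity>\<close> if \<open>\<Delta> = \<infinity>\<close>.
\<close>

definition distance_approximation :: "graph_property \<Rightarrow> query_algorithm \<Rightarrow> bool" where
  "distance_approximation P A \<longleftrightarrow>
     (\<forall>n\<ge>1. \<forall>E. graph n E \<longrightarrow> (\<forall>\<epsilon>. 0 < \<epsilon> \<and> \<epsilon> < 1 \<longrightarrow>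
        measure_pmf.prob (A n \<epsilon>)
          {t. dist_to_property n E P - ereal \<epsilon> \<le> run E t \<and>
              run E t \<le> dist_to_property n E P + ereal \<epsilon>} \<ge> 2 / 3))"

text \<open>Worst case over the input graph, its number of vertices and the internal randomness.\<close>

definition query_complexity_le :: "query_algorithm \<Rightarrow> (real \<Rightarrow> real) \<Rightarrow> bool" where
  "query_complexity_le A q \<longleftrightarrow>
     (\<forall>n\<ge>1. \<forall>E. graph n E \<longrightarrow> (\<forall>\<epsilon>. 0 < \<epsilon> \<and> \<epsilon> < 1 \<longrightarrow>
        (\<forall>t\<in>set_pmf (A n \<epsilon>). real (num_queries E t) \<le> q \<epsilon>)))"

text \<open>Evaluation of a polynomial in two variables, the coefficients being polynomials in \<open>x\<close>.\<close>

definition poly2 :: "real poly poly \<Rightarrow> real \<Rightarrow> real \<Rightarrow> real" where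
  "poly2 p x y = poly (poly p [:y:]) x"

end

theory Submission
  imports Defs
begin

text \<open>
  Editing inside the classes of a fixed vertex partition shows that the distance to the property is
  the minimum, over partitions of \<open>G\<close> and over pairs \<open>(G', V')\<close> satisfying \<open>\<Phi>\<close> with the same part
  sizes, of the total difference of the edge counts. It therefore suffices to know approximately
  which vectors of part sizes and edge densities are realised by partitions of \<open>G\<close>.

  Let \<open>g\<close> be the indicator of a partition and let \<open>f\<close> be a fractional partition. If for most columns
  of the adjacency matrix \<open>f\<close> and \<open>g\<close> have nearly the same inner products with the column, then all
  their densities nearly agree. Such an \<open>f\<close> is found by multiplicative weights: as long as many
  columns are violated, a random vertex \<open>u\<close> gives a violated column with noticeable probability, and
  tilting \<open>f\<close> along it lowers the relative entropy to \<open>g\<close>. After polynomially many random vertices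
  there is, with high probability, a sequence of polynomially many advice bits for which the
  resulting softmax partition \<open>f\<close> is good; its value at \<open>v\<close> depends only on the adjacencies of \<open>v\<close>
  to the sampled vertices. The algorithm tries all advice strings and estimates the sizes and
  densities of all candidates from one sample of random pairs (Hoeffding and a union bound). Every
  candidate can be rounded to a genuine partition with nearly the same sizes and densities, so no
  candidate underestimates the distance by much.
\<close>

section \<open>Sampling\<close>

lemma measure_bind_pmf:
  "measure_pmf.prob (bind_pmf p f) S = measure_pmf.expectation p (\<lambda>x. measure_pmf.prob (f x) S)"
proof -
  have "ennreal (measure_pmf.prob (bind_pmf p f) S) =
      (\<integral>\<^sup>+x. ennreal (measure_pmf.prob (f x) S) \<partial>measure_pmf p)"
    by (simp flip: measure_pmf.emeasure_eq_measure)
  also have "\<dots> = ennreal (measure_pmf.expectation p (\<lambda>x. measure_pmf.prob (f x) S))"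
    by (intro nn_integral_eq_integral measure_pmf.integrable_const_bound[where B = 1]) auto
  finally show ?thesis
    by (simp add: integral_nonneg_AE)
qed

text \<open>Drawing the first component first turns the probability into an average of conditional
  ones. This allows the union bound over advice to be made with the sampled columns fixed.\<close>

lemma prob_pair_pmf_le:
  assumes "\<And>x. x \<in> set_pmf p \<Longrightarrow> measure_pmf.prob q {y. P x y} \<le> a"
  shows "measure_pmf.prob (pair_pmf p q) {z. P (fst z) (snd z)} \<le> a"
proof -
  have "pair_pmf p q = bind_pmf p (\<lambda>x. map_pmf (Pair x) q)"
    by (simp add: pair_pmf_def map_pmf_def)
  hence "measure_pmf.prob (pair_pmf p q) {z. P (fst z) (snd z)} =
      measure_pmf.expectation p (\<lambda>x. measure_pmf.prob q {y. P x y})"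
    by (simp add: measure_bind_pmf vimage_def)
  also have "\<dots> \<le> measure_pmf.expectation p (\<lambda>_. a)"
    by (intro integral_mono_AE measure_pmf.integrable_const_bound[where B = "max 1 \<bar>a\<bar>"])
       (auto simp: AE_measure_pmf_iff assms le_max_iff_disj)
  finally show ?thesis by simp
qed

text \<open>The coordinates of a \<open>Pi_pmf\<close> sample are independent copies of
  \<open>p\<close>, so Hoeffding's inequality applies to their sum with deviation
  \<open>r * \<delta>\<close>.\<close>

lemma Hoeffding_sample_mean:
  fixes \<phi> :: "'a \<Rightarrow> real"
  assumes r: "r > 0" and \<delta>: "\<delta> \<ge> 0" and \<phi>: "\<And>z. z \<in> set_pmf p \<Longrightarrow> \<phi> z \<in> {0..1}"
  shows "measure_pmf.prob (Pi_pmf {..<r} d (\<lambda>_. p))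
      {h. \<bar>(\<Sum>l<r. \<phi> (h l)) / real r - measure_pmf.expectation p \<phi>\<bar> \<ge> \<delta>} \<le>
      2 * exp (- 2 * real r * \<delta>\<^sup>2)"
proof -
  define M where "M = Pi_pmf {..<r} d (\<lambda>_. p)"
  have comp: "measure_pmf.expectation M (\<lambda>h. \<phi> (h l)) = measure_pmf.expectation p \<phi>" if "l < r" for l
  proof -
    have "measure_pmf.expectation M (\<lambda>h. \<phi> (h l)) = measure_pmf.expectation (map_pmf (\<lambda>h. h l) M) \<phi>"
      by simp
    also have "map_pmf (\<lambda>h. h l) M = p"
      using that by (simp add: M_def Pi_pmf_component)
    finally show ?thesis .
  qed
  interpret Hoeffding_ineq M "{..<r}" "\<lambda>l h. \<phi> (h l)" "\<lambda>_. 0" "\<lambda>_. 1"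
    "\<Sum>l<r. measure_pmf.expectation M (\<lambda>h. \<phi> (h l))"
  proof unfold_locales
    show "prob_space.indep_vars (measure_pmf M) (\<lambda>_. borel) (\<lambda>l h. \<phi> (h l)) {..<r}"
      unfolding M_def
      by (intro prob_space.indep_vars_compose2[OF _ indep_vars_Pi_pmf])
         (auto simp: measure_pmf.prob_space_axioms)
  next
    fix l assume "l \<in> {..<r}"
    thus "AE h in M. \<phi> (h l) \<in> {0..1}"
      using \<phi> by (auto simp: AE_measure_pmf_iff M_def set_Pi_pmf PiE_dflt_def)
  qed auto
  have "{h. \<bar>(\<Sum>l<r. \<phi> (h l)) / real r - measure_pmf.expectation p \<phi>\<bar> \<ge> \<delta>} =
      {h. \<bar>(\<Sum>l<r. \<phi> (h l)) - (\<Sum>l<r. measure_pmf.expectation M (\<lambda>h. \<phi> (h l)))\<bar> \<ge> real r * \<delta>}"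
  proof (intro Collect_cong)
    fix h
    have "(\<Sum>l<r. \<phi> (h l)) - (\<Sum>l<r. measure_pmf.expectation M (\<lambda>h. \<phi> (h l))) =
        real r * ((\<Sum>l<r. \<phi> (h l)) / real r - measure_pmf.expectation p \<phi>)"
      using r by (simp add: comp field_simps)
    thus "\<bar>(\<Sum>l<r. \<phi> (h l)) / real r - measure_pmf.expectation p \<phi>\<bar> \<ge> \<delta> \<longleftrightarrow>
      \<bar>(\<Sum>l<r. \<phi> (h l)) - (\<Sum>l<r. measure_pmf.expectation M (\<lambda>h. \<phi> (h l)))\<bar> \<ge> real r * \<delta>"
      using r by (simp add: abs_mult)
  qed
  moreover have "measure_pmf.prob M {h. \<bar>(\<Sum>l<r. \<phi> (h l)) - 
      (\<Sum>l<r. measure_pmf.expectation M (\<lambda>h. \<phi> (h l)))\<bar> \<ge> real r * \<delta>} \<le>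
      2 * exp (-2 * (real r * \<delta>)\<^sup>2 / (\<Sum>l<r. (1 - 0)\<^sup>2))"
    using Hoeffding_ineq_abs_ge[of "real r * \<delta>"] r \<delta> by simp
  moreover have "-2 * (real r * \<delta>)\<^sup>2 / (\<Sum>l<r. (1 - 0)\<^sup>2) = - 2 * real r * \<delta>\<^sup>2"
    using r by (simp add: power2_eq_square)
  ultimately show ?thesis unfolding M_def by simp
qed

section \<open>Multiplicative weights on the vertex labels\<close>

definition adj :: "edges \<Rightarrow> nat \<Rightarrow> nat \<Rightarrow> real" where
  "adj E u v = of_bool ({u, v} \<in> E)"

lemma adj_bounds [simp]: "0 \<le> adj E u v" "adj E u v \<le> 1"
  by (auto simp: adj_def)

lemma adj_commute: "adj E u v = adj E v u"
  by (simp add: adj_def insert_commute)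

definition label_ind :: "(nat \<Rightarrow> nat) \<Rightarrow> nat \<Rightarrow> nat \<Rightarrow> real" where
  "label_ind c i v = of_bool (c v = i)"

text \<open>The parameters \<open>\<theta>\<close> are logarithms of multiplicative weights. No
  label ever gets weight 0, which keeps the relative entropy to any labelling finite.\<close>

definition softmax :: "nat \<Rightarrow> (nat \<Rightarrow> nat \<Rightarrow> real) \<Rightarrow> nat \<Rightarrow> nat \<Rightarrow> real" where
  "softmax k \<theta> i v = exp (\<theta> i v) / (\<Sum>l=1..k. exp (\<theta> l v))"

lemma softmax_denom_pos: "k \<ge> 1 \<Longrightarrow> (\<Sum>l=1..k::nat. exp (\<theta> l v :: real)) > 0"
  by (intro sum_pos) auto

lemma softmax_pos: "k \<ge> 1 \<Longrightarrow> softmax k \<theta> i v > 0"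
  using softmax_denom_pos[of k \<theta> v] by (simp add: softmax_def)

lemma softmax_le_1:
  assumes "i \<in> {1..k}"
  shows "softmax k \<theta> i v \<le> 1"
proof -
  have "exp (\<theta> i v) \<le> (\<Sum>l=1..k. exp (\<theta> l v))"
    using assms by (intro member_le_sum) auto
  thus ?thesis
    using assms softmax_denom_pos[of k \<theta> v] by (simp add: softmax_def)
qed

lemma sum_softmax: "k \<ge> 1 \<Longrightarrow> (\<Sum>i=1..k. softmax k \<theta> i v) = 1"
  using softmax_denom_pos[of k \<theta> v] by (simp add: softmax_def flip: sum_divide_distrib)

text \<open>A step \<open>(i, s, b)\<close> of advice shifts the weight of label \<open>i\<close> along the column of the sampled
  vertex \<open>u\<close>, or uniformly if \<open>b\<close>; \<open>s = 0\<close> makes it void.\<close>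

definition tilt :: "real \<Rightarrow> edges \<Rightarrow> nat \<Rightarrow> nat \<times> real \<times> bool \<Rightarrow> (nat \<Rightarrow> nat \<Rightarrow> real) \<Rightarrow> nat \<Rightarrow> nat \<Rightarrow> real"
  where "tilt \<eta> E u a \<theta> = (case a of (i, s, b) \<Rightarrow>
    (\<lambda>j v. \<theta> j v + (if j = i then \<eta> * s * (if b then 1 else adj E v u) else 0)))"

fun tilts :: "real \<Rightarrow> edges \<Rightarrow> (nat \<Rightarrow> nat \<Rightarrow> real) \<Rightarrow> nat list \<Rightarrow> (nat \<times> real \<times> bool) list \<Rightarrow> nat \<Rightarrow> nat \<Rightarrow> real"
  where
  "tilts \<eta> E \<theta> (u # us) (a # as) = tilts \<eta> E (tilt \<eta> E u a \<theta>) us as"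
| "tilts \<eta> E \<theta> us as = \<theta>"

text \<open>The alphabet has only \<open>6 * k\<close> letters, so a union bound over all strings
  costs just \<open>6 * k * m\<close> in the exponent. The letters with sign 0 pad shorter advice to
  length \<open>m\<close>.\<close>

definition advices :: "nat \<Rightarrow> nat \<Rightarrow> (nat \<times> real \<times> bool) list set" where
  "advices k m = {as. set as \<subseteq> {1..k} \<times> {-1, 0, 1} \<times> UNIV \<and> length as = m}"

lemma finite_advices: "finite (advices k m)"
  unfolding advices_def by (intro finite_lists_length_eq) auto

lemma card_advices: "card (advices k m) = (6 * k) ^ m"
  unfolding advices_def
  by (subst card_lists_length_eq) (auto simp: card_cartesian_product)

text \<open>The relative entropy, summed over the vertices, of the point mass at \<open>c v\<close>
  with respect to the softmax distribution at \<open>v\<close>.\<close>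

definition potential :: "nat \<Rightarrow> nat \<Rightarrow> (nat \<Rightarrow> nat) \<Rightarrow> (nat \<Rightarrow> nat \<Rightarrow> real) \<Rightarrow> real" where
  "potential k n c \<theta> = (\<Sum>v<n. - ln (softmax k \<theta> (c v) v))"

lemma potential_nonneg:
  assumes "k \<ge> 1" "c ` {..<n} \<subseteq> {1..k}"
  shows "potential k n c \<theta> \<ge> 0"
  unfolding potential_def
proof (intro sum_nonneg)
  fix v assume "v \<in> {..<n}"
  hence "c v \<in> {1..k}" using assms by blast
  thus "- ln (softmax k \<theta> (c v) v) \<ge> 0"
    using softmax_le_1 softmax_pos[OF assms(1), of \<theta> "c v" v] by simp
qed

lemma potential_0:
  assumes "k \<ge> 1"
  shows "potential k n c (\<lambda>_ _. 0) = real n * ln k"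
  using assms by (simp add: potential_def softmax_def ln_div)

text \<open>For negative \<open>x\<close>, multiply \<open>1 - x \<le> exp (- x)\<close> by
  \<open>1 + x + x^2\<close> and note that the product on the left is
  \<open>1 - x^3 \<ge> 1\<close>.\<close>

lemma exp_le_quadratic:
  fixes x :: real
  assumes "\<bar>x\<bar> \<le> 1"
  shows "exp x \<le> 1 + x + x\<^sup>2"
proof (cases "x \<ge> 0")
  case True
  thus ?thesis using assms by (intro exp_bound) auto
next
  case False
  have "1 - x \<le> exp (- x)" using exp_ge_add_one_self[of "-x"] by simp
  moreover have "1 \<le> (1 + x + x\<^sup>2) * (1 - x)"
  proof -
    have "(1 + x + x\<^sup>2) * (1 - x) = 1 - x ^ 3"
      by (simp add: power2_eq_square power3_eq_cube algebra_simps)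
    moreover have "x ^ 3 \<le> 0" using False by (simp add: power_le_zero_eq)
    ultimately show ?thesis by simp
  qed
  moreover have "1 + x + x\<^sup>2 \<ge> 0" using assms by (simp add: abs_le_iff add_nonneg_nonneg)
  ultimately have "1 \<le> (1 + x + x\<^sup>2) * exp (- x)"
    by (meson mult_left_mono order_trans)
  thus ?thesis by (simp add: exp_minus field_simps)
qed

text \<open>The standard multiplicative weights estimate. The exponent of the true label contributes
  the linear term with \<open>label_ind\<close>; the logarithm of the normalising sum contributes
  the one with \<open>softmax\<close>, up to a second-order error of at most \<eta>^2 per
  vertex.\<close>

lemma potential_tilt_le:
  assumes k: "k \<ge> 1" and i: "i \<in> {1..k}" and \<eta>: "0 \<le> \<eta>" "\<eta> \<le> 1" and s: "\<bar>s\<bar> \<le> 1"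
    and w: "w = (\<lambda>v. if b then 1 else adj E v u)"
  shows "potential k n c (tilt \<eta> E u (i, s, b) \<theta>) \<le>
    potential k n c \<theta> + \<eta> * s * (\<Sum>v<n. (softmax k \<theta> i v - label_ind c i v) * w v) + \<eta>\<^sup>2 * n"
proof -
  define \<theta>' where "\<theta>' = tilt \<eta> E u (i, s, b) \<theta>"
  have step: "- ln (softmax k \<theta>' (c v) v) \<le> - ln (softmax k \<theta> (c v) v) +
      \<eta> * s * ((softmax k \<theta> i v - label_ind c i v) * w v) + \<eta>\<^sup>2" for v
  proof -
    define x where "x = \<eta> * s * w v"
    define Z Z' where "Z = (\<Sum>l=1..k. exp (\<theta> l v))" and "Z' = (\<Sum>l=1..k. exp (\<theta>' l v))"
    define y where "y = softmax k \<theta> i v"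
    have Z: "Z > 0" "Z' > 0" using softmax_denom_pos[OF k] by (auto simp: Z_def Z'_def)
    have y: "0 < y" "y \<le> 1" using softmax_pos[OF k] softmax_le_1[OF i] by (auto simp: y_def)
    have w01: "0 \<le> w v" "w v \<le> 1" by (auto simp: w)
    have x_abs: "\<bar>x\<bar> \<le> \<eta>"
    proof -
      have "\<bar>x\<bar> = \<eta> * (\<bar>s\<bar> * w v)" using \<eta> w01 by (simp add: x_def abs_mult)
      also have "\<dots> \<le> \<eta> * 1" using \<eta> w01 s by (intro mult_left_mono mult_le_one) auto
      finally show ?thesis by simp
    qed
    have \<theta>': "\<theta>' j v = \<theta> j v + (if j = i then x else 0)" for j
      by (simp add: \<theta>'_def tilt_def x_def w)
    \<comment> \<open>Only the summand of label \<open>i\<close> changes, so the normalising sum is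
      multiplied by \<open>1 + y * (exp x - 1)\<close>, where \<open>y\<close> is the old weight of
      \<open>i\<close>.\<close>
    have "Z' = (\<Sum>l=1..k. exp (\<theta> l v) + (if l = i then exp (\<theta> i v) * (exp x - 1) else 0))"
      unfolding Z'_def by (intro sum.cong) (auto simp: \<theta>' exp_add algebra_simps)
    also have "\<dots> = Z + exp (\<theta> i v) * (exp x - 1)"
      using i by (simp add: sum.distrib Z_def)
    also have "\<dots> = Z * (1 + y * (exp x - 1))"
    proof -
      have "exp (\<theta> i v) = Z * y" using Z by (simp add: y_def softmax_def Z_def)
      thus ?thesis by (simp add: algebra_simps)
    qed
    finally have Z': "Z' = Z * (1 + y * (exp x - 1))" .
    hence pos: "1 + y * (exp x - 1) > 0" using Z by (simp add: zero_less_mult_iff)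
    have "ln Z' = ln Z + ln (1 + y * (exp x - 1))"
      using Z pos by (simp add: Z' ln_mult)
    also have "ln (1 + y * (exp x - 1)) \<le> y * (exp x - 1)"
      using ln_le_minus_one[OF pos] by simp
    also have "\<dots> \<le> y * (x + x\<^sup>2)"
      using exp_le_quadratic[of x] x_abs \<eta> y by (intro mult_left_mono) auto
    also have "\<dots> \<le> y * x + \<eta>\<^sup>2"
    proof -
      have "x\<^sup>2 \<le> \<eta>\<^sup>2" using x_abs by (metis abs_le_square_iff abs_of_nonneg \<eta>(1))
      hence "y * x\<^sup>2 \<le> 1 * \<eta>\<^sup>2" using y by (intro mult_mono) auto
      thus ?thesis by (simp add: algebra_simps)
    qed
    finally have lnZ: "ln Z' \<le> ln Z + (y * x + \<eta>\<^sup>2)" by simp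
    have "- ln (softmax k \<theta>' (c v) v) = ln Z' - \<theta>' (c v) v"
      using Z unfolding softmax_def Z'_def by (simp add: ln_div)
    moreover have "- ln (softmax k \<theta> (c v) v) = ln Z - \<theta> (c v) v"
      using Z unfolding softmax_def Z_def by (simp add: ln_div)
    ultimately show ?thesis
      using lnZ unfolding \<theta>' y_def[symmetric]
      by (simp add: label_ind_def x_def algebra_simps split: if_splits)
  qed
  have "potential k n c \<theta>' \<le> (\<Sum>v<n. - ln (softmax k \<theta> (c v) v) +
      \<eta> * s * ((softmax k \<theta> i v - label_ind c i v) * w v) + \<eta>\<^sup>2)"
    unfolding potential_def by (intro sum_mono step)
  also have "\<dots> = potential k n c \<theta> + \<eta> * s * (\<Sum>v<n. (softmax k \<theta> i v - label_ind c i v) * w v) + \<eta>\<^sup>2 * n"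
    unfolding potential_def sum.distrib sum_distrib_left by simp
  finally show ?thesis by (simp add: \<theta>'_def)
qed

text \<open>A \<delta> fraction of exceptional columns is tolerated because random vertices cannot
  detect fewer. Such columns move a density by at most \<delta> n^2 per argument.\<close>

definition settled :: "nat \<Rightarrow> nat \<Rightarrow> edges \<Rightarrow> real \<Rightarrow> (nat \<Rightarrow> nat) \<Rightarrow> (nat \<Rightarrow> nat \<Rightarrow> real) \<Rightarrow> bool" where
  "settled k n E \<delta> c f \<longleftrightarrow>
    (\<forall>i\<in>{1..k}. \<bar>\<Sum>v<n. f i v - label_ind c i v\<bar> \<le> \<delta> * n) \<and>
    real (card {u\<in>{..<n}. \<exists>i\<in>{1..k}. \<bar>\<Sum>v<n. (f i v - label_ind c i v) * adj E v u\<bar> > \<delta> * n}) \<le> \<delta> * n"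

lemma tilt_void: "tilt \<eta> E u (i, 0, b) \<theta> = \<theta>"
  by (simp add: tilt_def fun_eq_iff)

lemma tilts_void: "tilts \<eta> E \<theta> us (replicate m (i, 0, b)) = \<theta>"
proof (induction m arbitrary: us)
  case (Suc m)
  thus ?case by (cases us) (auto simp: tilt_void)
qed (cases us; simp)

text \<open>Tilting against the sign of the violation gains more than \<eta> \<delta> n to first
  order and loses at most \<eta>^2 n. The choice \<eta> = \<delta>/2 maximises the guaranteed
  difference, which is \<delta>^2 n / 4.\<close>

lemma ex_progress_tilt:
  assumes k: "k \<ge> 1" and \<delta>: "0 < \<delta>" "\<delta> \<le> 1" and i: "i \<in> {1..k}"
    and w: "w = (\<lambda>v. if b then 1 else adj E v u)"
    and viol: "\<bar>\<Sum>v<n. (softmax k \<theta> i v - label_ind c i v) * w v\<bar> > \<delta> * n"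
  shows "\<exists>s\<in>{-1, 0, 1}. potential k n c (tilt (\<delta>/2) E u (i, s, b) \<theta>) \<le> potential k n c \<theta> - \<delta>\<^sup>2 / 4 * n"
proof -
  define S where "S = (\<Sum>v<n. (softmax k \<theta> i v - label_ind c i v) * w v)"
  define s where "s = - sgn S"
  have "s * S = - \<bar>S\<bar>" by (simp add: s_def sgn_if abs_if)
  hence "\<delta>/2 * s * S \<le> - (\<delta>/2) * (\<delta> * n)"
    using viol \<delta> unfolding S_def[symmetric] by (simp add: mult.assoc)
  moreover have "potential k n c (tilt (\<delta>/2) E u (i, s, b) \<theta>) \<le>
      potential k n c \<theta> + \<delta>/2 * s * S + (\<delta>/2)\<^sup>2 * n"
    unfolding S_def using \<delta> by (intro potential_tilt_le k i w) (auto simp: s_def sgn_if)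
  ultimately have "potential k n c (tilt (\<delta>/2) E u (i, s, b) \<theta>) \<le> potential k n c \<theta> - \<delta>\<^sup>2 / 4 * n"
    by (simp add: power2_eq_square field_simps)
  moreover have "s \<in> {-1, 0, 1}" by (auto simp: s_def sgn_if)
  ultimately show ?thesis by blast
qed

text \<open>Every step that meets a violated column lowers the potential by \<open>\<delta>\<^sup>2 n / 4\<close>, and an unsettled
  state meets one with probability at least \<open>\<delta>\<close>, so the expected number of unsettled steps
  is at most the initial potential divided by \<open>\<delta>\<^sup>3 n / 4\<close>.\<close>

lemma prob_not_settled_le:
  assumes k: "k \<ge> 1" and \<delta>: "0 < \<delta>" "\<delta> \<le> 1" and n: "n \<ge> 1" and c: "c ` {..<n} \<subseteq> {1..k}"
  shows "m * measure_pmf.prob (replicate_pmf m (pmf_of_set {..<n}))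
      {us. \<not> (\<exists>as\<in>advices k m. settled k n E \<delta> c (softmax k (tilts (\<delta>/2) E \<theta> us as)))} \<le>
    potential k n c \<theta> / (\<delta>^3 / 4 * n)"
proof (induction m arbitrary: \<theta>)
  case 0
  show ?case using potential_nonneg[OF k c, of \<theta>] \<delta> by simp
next
  case (Suc m)
  define U where "U = pmf_of_set {..<n}"
  have n0: "{..<n} \<noteq> {}" using n by (auto simp: lessThan_empty_iff)
  define bad where "bad m \<theta> = {us. \<not> (\<exists>as\<in>advices k m.
    settled k n E \<delta> c (softmax k (tilts (\<delta>/2) E \<theta> us as)))}" for m \<theta>
  define q where "q m \<theta> = measure_pmf.prob (replicate_pmf m U) (bad m \<theta>)" for m \<theta>
  define \<kappa> where "\<kappa> = \<delta>^3 / 4 * n"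
  have \<kappa>: "\<kappa> > 0" using \<delta> n by (simp add: \<kappa>_def)
  have IH: "m * q m \<theta> \<le> potential k n c \<theta> / \<kappa>" for \<theta>
    using Suc.IH[of \<theta>] by (simp add: q_def bad_def U_def \<kappa>_def)
  have "Suc m * q (Suc m) \<theta> \<le> potential k n c \<theta> / \<kappa>"
  proof (cases "settled k n E \<delta> c (softmax k \<theta>)")
    case True
    have "bad (Suc m) \<theta> = {}"
    proof -
      have "replicate (Suc m) (1, 0, True) \<in> advices k (Suc m)"
        using k by (auto simp: advices_def)
      moreover have "settled k n E \<delta> c (softmax k
          (tilts (\<delta>/2) E \<theta> us (replicate (Suc m) (1, 0, True))))" for us
        using True by (simp only: tilts_void)
      ultimately show ?thesis unfolding bad_def by blast
    qed
    thus ?thesis using potential_nonneg[OF k c, of \<theta>] \<kappa> by (simp add: q_def)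
  next
    case False
    define B where "B = {u\<in>{..<n}. \<exists>i\<in>{1..k}.
      \<bar>\<Sum>v<n. (softmax k \<theta> i v - label_ind c i v) * adj E v u\<bar> > \<delta> * n}"
    \<comment> \<open>\<open>D\<close> is a set of vertices whose sampling permits progress. If few
      columns are violated, some part size is, and the uniform tilt works whatever the vertex, so
      \<open>D\<close> is everything; otherwise \<open>D\<close> is the set \<open>B\<close> of
      violated columns.\<close>
    have "\<exists>D \<subseteq> {..<n}. real (card D) \<ge> \<delta> * n \<and> (\<forall>u\<in>D. \<exists>a. a \<in> {1..k} \<times> {-1, 0, 1} \<times> UNIV \<and>
        potential k n c (tilt (\<delta>/2) E u a \<theta>) \<le> potential k n c \<theta> - \<delta>\<^sup>2 / 4 * n)"
    proof (cases "real (card B) \<le> \<delta> * n")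
      case True
      then obtain i where i: "i \<in> {1..k}" "\<bar>\<Sum>v<n. softmax k \<theta> i v - label_ind c i v\<bar> > \<delta> * n"
        using False by (auto simp: settled_def B_def not_le)
      have "\<exists>a. a \<in> {1..k} \<times> {-1, 0, 1} \<times> UNIV \<and>
        potential k n c (tilt (\<delta>/2) E u a \<theta>) \<le> potential k n c \<theta> - \<delta>\<^sup>2 / 4 * n" for u
        using ex_progress_tilt[OF k \<delta> i(1) refl, where b = True and u = u and E = E and \<theta> = \<theta> and c = c and n = n] i
        by auto
      thus ?thesis using \<delta> by (intro exI[of _ "{..<n}"]) (auto intro: mult_left_le_one_le)
    next
      case False
      have "\<exists>a. a \<in> {1..k} \<times> {-1, 0, 1} \<times> UNIV \<and>
        potential k n c (tilt (\<delta>/2) E u a \<theta>) \<le> potential k n c \<theta> - \<delta>\<^sup>2 / 4 * n" if uB: "u \<in> B" for u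
      proof -
        obtain i where i: "i \<in> {1..k}" "\<bar>\<Sum>v<n. (softmax k \<theta> i v - label_ind c i v) * adj E v u\<bar> > \<delta> * n"
          using uB unfolding B_def by blast
        thus ?thesis
          using ex_progress_tilt[OF k \<delta> i(1) refl, where b = False and u = u and E = E and \<theta> = \<theta> and c = c and n = n]
          by auto
      qed
      thus ?thesis using False by (intro exI[of _ B]) (auto simp: B_def)
    qed
    then obtain D where D: "D \<subseteq> {..<n}" "real (card D) \<ge> \<delta> * n"
      and "\<forall>u\<in>D. \<exists>a. a \<in> {1..k} \<times> {-1, 0, 1} \<times> UNIV \<and>
        potential k n c (tilt (\<delta>/2) E u a \<theta>) \<le> potential k n c \<theta> - \<delta>\<^sup>2 / 4 * n" by blast
    then obtain a0 where a0: "\<And>u. u \<in> D \<Longrightarrow> a0 u \<in> {1..k} \<times> {-1, 0, 1} \<times> UNIV"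
        "\<And>u. u \<in> D \<Longrightarrow> potential k n c (tilt (\<delta>/2) E u (a0 u) \<theta>) \<le> potential k n c \<theta> - \<delta>\<^sup>2 / 4 * n"
      by metis
    \<comment> \<open>Outside \<open>D\<close> the advice is void, so the potential stays the same
      there.\<close>
    define a where "a u = (if u \<in> D then a0 u else (1, 0, True))" for u
    have a: "a u \<in> {1..k} \<times> {-1, 0, 1} \<times> UNIV" for u
      using a0 k by (auto simp: a_def)
    have pot: "potential k n c (tilt (\<delta>/2) E u (a u) \<theta>) \<le>
        potential k n c \<theta> - (if u \<in> D then \<delta>\<^sup>2 / 4 * n else 0)" for u
      using a0 by (auto simp: a_def tilt_void)
    \<comment> \<open>Good advice for the tail, started in the tilted state, extends by the letter
      \<open>a u\<close>. Hence failure on \<open>u # us\<close> forces failure on \<open>us\<close>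
      from that state, and the induction hypothesis applies for each \<open>u\<close>.\<close>
    have sub: "{us. u # us \<in> bad (Suc m) \<theta>} \<subseteq> bad m (tilt (\<delta>/2) E u (a u) \<theta>)" for u
    proof -
      have "u # us \<notin> bad (Suc m) \<theta>" if "us \<notin> bad m (tilt (\<delta>/2) E u (a u) \<theta>)" for us
      proof -
        from that obtain as where "as \<in> advices k m"
          "settled k n E \<delta> c (softmax k (tilts (\<delta>/2) E (tilt (\<delta>/2) E u (a u) \<theta>) us as))"
          by (auto simp: bad_def)
        moreover have "a u # as \<in> advices k (Suc m)"
          using a[of u] \<open>as \<in> advices k m\<close> by (auto simp: advices_def)
        ultimately show ?thesis by (auto simp: bad_def intro!: bexI[of _ "a u # as"])
      qed
      thus ?thesis by blast
    qed
    have "q (Suc m) \<theta> = measure_pmf.expectation U (\<lambda>u. measure_pmf.prob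
        (map_pmf (Cons u) (replicate_pmf m U)) (bad (Suc m) \<theta>))"
      by (simp add: q_def measure_bind_pmf map_pmf_def)
    also have "\<dots> = (\<Sum>u<n. measure_pmf.prob (replicate_pmf m U) {us. u # us \<in> bad (Suc m) \<theta>}) / n"
      unfolding U_def using n0 by (subst integral_pmf_of_set) (auto simp: vimage_def)
    also have "\<dots> \<le> (\<Sum>u<n. q m (tilt (\<delta>/2) E u (a u) \<theta>)) / n"
      unfolding q_def by (intro divide_right_mono sum_mono measure_pmf.finite_measure_mono sub) auto
    finally have "m * q (Suc m) \<theta> \<le> m * ((\<Sum>u<n. q m (tilt (\<delta>/2) E u (a u) \<theta>)) / n)"
      by (intro mult_left_mono) auto
    also have "\<dots> = (\<Sum>u<n. m * q m (tilt (\<delta>/2) E u (a u) \<theta>)) / n"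
      by (simp add: sum_distrib_left)
    also have "\<dots> \<le> (\<Sum>u<n. (potential k n c \<theta> - (if u \<in> D then \<delta>\<^sup>2 / 4 * n else 0)) / \<kappa>) / n"
      using \<kappa> by (intro divide_right_mono sum_mono order_trans[OF IH] pot) auto
    also have "(\<Sum>u<n. (potential k n c \<theta> - (if u \<in> D then \<delta>\<^sup>2 / 4 * n else 0)) / \<kappa>) =
        (n * potential k n c \<theta> - card D * (\<delta>\<^sup>2 / 4 * n)) / \<kappa>"
    proof -
      have "{..<n} \<inter> D = D" using D by auto
      thus ?thesis
        by (simp add: sum_subtractf sum.If_cases flip: sum_divide_distrib)
    qed
    also have "\<dots> / n \<le> (n * potential k n c \<theta> - (\<delta> * n) * (\<delta>\<^sup>2 / 4 * n)) / \<kappa> / n"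
      using D \<kappa> \<delta> by (intro divide_right_mono diff_left_mono mult_right_mono) auto
    also have "\<dots> = potential k n c \<theta> / \<kappa> - 1"
    proof -
      have "(\<delta> * n) * (\<delta>\<^sup>2 / 4 * n) = n * \<kappa>"
        by (simp add: \<kappa>_def power2_eq_square power3_eq_cube)
      thus ?thesis using \<kappa> n by (simp add: diff_divide_distrib)
    qed
    finally have "m * q (Suc m) \<theta> \<le> potential k n c \<theta> / \<kappa> - 1" .
    \<comment> \<open>The expected drop of the potential has paid for one unit, and
      \<open>q (Suc m) \<theta> \<le> 1\<close> spends it on passing from factor \<open>m\<close> to
      \<open>Suc m\<close>.\<close>
    moreover have "q (Suc m) \<theta> \<le> 1" by (simp add: q_def)
    ultimately show ?thesis by (simp add: algebra_simps)
  qed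
  thus ?case by (simp add: q_def bad_def U_def \<kappa>_def)
qed

section \<open>Densities and rounding\<close>

text \<open>The sum runs over ordered pairs, so for a labelling an edge inside a part counts twice
  on the diagonal \<open>i = j\<close>.\<close>

definition density_form :: "nat \<Rightarrow> edges \<Rightarrow> (nat \<Rightarrow> nat \<Rightarrow> real) \<Rightarrow> nat \<Rightarrow> nat \<Rightarrow> real" where
  "density_form n E f i j = (\<Sum>u<n. \<Sum>v<n. adj E u v * f i u * f j v)"

text \<open>Exchange \<open>f\<close> for \<open>g\<close> in one argument at a time, through the
  mixed form with \<open>g i\<close> on the left and \<open>f j\<close> on the right. Each exchange
  is a sum of column inner products with weights in [0,1].\<close>

lemma density_form_diff_le:
  assumes f: "\<And>v. v < n \<Longrightarrow> f j v \<in> {0..1}" and g: "\<And>v. v < n \<Longrightarrow> g i v \<in> {0..1}"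
  shows "\<bar>density_form n E f i j - density_form n E g i j\<bar> \<le>
    (\<Sum>u<n. \<bar>\<Sum>v<n. (f i v - g i v) * adj E v u\<bar>) + (\<Sum>u<n. \<bar>\<Sum>v<n. (f j v - g j v) * adj E v u\<bar>)"
proof -
  define col where "col l u = (\<Sum>v<n. (f l v - g l v) * adj E v u)" for l u
  have "(\<Sum>v<n. f j v * col i v) = (\<Sum>v<n. \<Sum>u<n. adj E u v * f i u * f j v - adj E u v * g i u * f j v)"
    unfolding col_def by (intro sum.cong) (auto simp: sum_distrib_left algebra_simps)
  also have "\<dots> = (\<Sum>u<n. \<Sum>v<n. adj E u v * f i u * f j v - adj E u v * g i u * f j v)"
    by (rule sum.swap)
  finally have "(\<Sum>v<n. f j v * col i v) = \<dots>" .
  moreover have "(\<Sum>u<n. g i u * col j u) = (\<Sum>u<n. \<Sum>v<n. adj E u v * g i u * f j v - adj E u v * g i u * g j v)"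
    unfolding col_def by (intro sum.cong) (auto simp: sum_distrib_left algebra_simps adj_commute)
  ultimately have "density_form n E f i j - density_form n E g i j =
      (\<Sum>v<n. f j v * col i v) + (\<Sum>u<n. g i u * col j u)"
    by (simp add: density_form_def sum_subtractf)
  also have "\<bar>\<dots>\<bar> \<le> (\<Sum>v<n. \<bar>f j v * col i v\<bar>) + (\<Sum>u<n. \<bar>g i u * col j u\<bar>)"
    by (intro order_trans[OF abs_triangle_ineq] add_mono sum_abs)
  also have "\<dots> \<le> (\<Sum>v<n. \<bar>col i v\<bar>) + (\<Sum>u<n. \<bar>col j u\<bar>)"
    using f g by (intro add_mono sum_mono) (auto simp: abs_mult intro!: mult_left_le_one_le)
  finally show ?thesis by (simp add: col_def)
qed

lemma label_ind_bounds [simp]: "0 \<le> label_ind c i v" "label_ind c i v \<le> 1"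
  by (auto simp: label_ind_def)

lemma sum_label_ind: "(\<Sum>v<n. label_ind c i v) = real (card {v\<in>{..<n}. c v = i})"
  by (simp add: label_ind_def of_bool_def sum.If_cases Int_def)

text \<open>In each argument the ordinary columns contribute at most \<delta> n each, and the at
  most \<delta> n exceptional ones at most n each, which makes 2 \<delta> n^2.\<close>

lemma settled_density_form_diff_le:
  assumes st: "settled k n E \<delta> c f" and f: "\<And>i v. i \<in> {1..k} \<Longrightarrow> f i v \<in> {0..1}"
    and ij: "i \<in> {1..k}" "j \<in> {1..k}" and \<delta>: "\<delta> \<ge> 0"
  shows "\<bar>density_form n E f i j - density_form n E (label_ind c) i j\<bar> \<le> 4 * \<delta> * (real n)\<^sup>2"
proof -
  define col where "col l u = (\<Sum>v<n. (f l v - label_ind c l v) * adj E v u)" for l u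
  define B where "B = {u\<in>{..<n}. \<exists>i\<in>{1..k}. \<bar>col i u\<bar> > \<delta> * n}"
  have B: "real (card B) \<le> \<delta> * n" using st by (simp add: settled_def B_def col_def)
  have *: "(\<Sum>u<n. \<bar>col l u\<bar>) \<le> 2 * \<delta> * (real n)\<^sup>2" if l: "l \<in> {1..k}" for l
  proof -
    have le_n: "\<bar>col l u\<bar> \<le> n" for u
    proof -
      have "\<bar>col l u\<bar> \<le> (\<Sum>v<n. \<bar>(f l v - label_ind c l v) * adj E v u\<bar>)"
        unfolding col_def by (rule sum_abs)
      also have "\<dots> \<le> (\<Sum>v<n. 1)"
      proof (intro sum_mono)
        fix v
        have "\<bar>f l v - label_ind c l v\<bar> \<le> 1"
          using f[OF l, of v] by (auto simp: label_ind_def)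
        thus "\<bar>(f l v - label_ind c l v) * adj E v u\<bar> \<le> 1"
          by (simp add: abs_mult mult_le_one)
      qed
      finally show ?thesis by simp
    qed
    have "(\<Sum>u<n. \<bar>col l u\<bar>) \<le> (\<Sum>u<n. \<delta> * n + (if u \<in> B then real n else 0))"
    proof (intro sum_mono)
      fix u assume "u \<in> {..<n}"
      show "\<bar>col l u\<bar> \<le> \<delta> * n + (if u \<in> B then real n else 0)"
      proof (cases "u \<in> B")
        case True
        thus ?thesis using le_n[of u] \<delta> by (simp add: add_increasing)
      next
        case False
        have "\<bar>col l u\<bar> \<le> \<delta> * n"
        proof (rule ccontr)
          assume "\<not> \<bar>col l u\<bar> \<le> \<delta> * n"
          hence "\<bar>col l u\<bar> > \<delta> * n" by simp
          hence "u \<in> B" unfolding B_def using \<open>u \<in> {..<n}\<close> l by blast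
          thus False using False by blast
        qed
        thus ?thesis using False by simp
      qed
    qed
    also have "\<dots> = \<delta> * n * n + real (card B) * n"
    proof -
      have "{..<n} \<inter> B = B" by (auto simp: B_def)
      thus ?thesis by (simp add: sum.distrib sum.If_cases)
    qed
    also have "\<dots> \<le> \<delta> * n * n + (\<delta> * n) * n"
      using B by (intro add_left_mono mult_right_mono) auto
    finally show ?thesis by (simp add: power2_eq_square)
  qed
  have "\<bar>density_form n E f i j - density_form n E (label_ind c) i j\<bar> \<le>
      (\<Sum>u<n. \<bar>col i u\<bar>) + (\<Sum>u<n. \<bar>col j u\<bar>)"
    unfolding col_def
  proof (rule density_form_diff_le)
    show "f j v \<in> {0..1}" for v by (rule f[OF ij(2)])
  qed simp
  also have "\<dots> \<le> 2 * \<delta> * (real n)\<^sup>2 + 2 * \<delta> * (real n)\<^sup>2"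
    using ij by (intro add_mono *)
  finally show ?thesis by simp
qed

text \<open>Derandomised independent rounding: the mean square error is at most the sum of the variances.\<close>

lemma ex_rounding:
  fixes f :: "nat \<Rightarrow> nat \<Rightarrow> real" and k :: nat and a :: "'t \<Rightarrow> nat \<Rightarrow> real"
  assumes k: "k \<ge> 1" and f: "\<And>i v. i \<in> {1..k} \<Longrightarrow> f i v > 0" "\<And>v. (\<Sum>i=1..k. f i v) = 1"
  shows "\<exists>d. d ` {..<n} \<subseteq> {1..k} \<and>
    (\<Sum>t\<in>T. \<Sum>i=1..k. (\<Sum>v<n. (label_ind d i v - f i v) * a t v)\<^sup>2) \<le> (\<Sum>t\<in>T. \<Sum>v<n. (a t v)\<^sup>2)"
proof (induction n)
  case 0
  show ?case by auto
next
  case (Suc n)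
  then obtain d where d: "d ` {..<n} \<subseteq> {1..k}"
    and IH: "(\<Sum>t\<in>T. \<Sum>i=1..k. (\<Sum>v<n. (label_ind d i v - f i v) * a t v)\<^sup>2) \<le> (\<Sum>t\<in>T. \<Sum>v<n. (a t v)\<^sup>2)"
    by blast
  define S where "S t i = (\<Sum>v<n. (label_ind d i v - f i v) * a t v)" for t i
  \<comment> \<open>\<open>L j\<close> is the total square error if vertex \<open>n\<close> receives
    label \<open>j\<close>; \<open>R\<close> is the previous error plus the new vertex's share of
    the allowance.\<close>
  define L where "L j = (\<Sum>t\<in>T. \<Sum>i=1..k. (S t i + (of_bool (j = i) - f i n) * a t n)\<^sup>2)" for j
  define R where "R = (\<Sum>t\<in>T. \<Sum>i=1..k. (S t i)\<^sup>2) + (\<Sum>t\<in>T. (a t n)\<^sup>2)"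
  \<comment> \<open>Under the distribution \<open>f _ n\<close> of the label, the increment is
    centred, so the cross term vanishes and only the Bernoulli variance remains.\<close>
  have mean: "(\<Sum>j=1..k. f j n * (s + (of_bool (j = i) - f i n) * b)\<^sup>2) = s\<^sup>2 + f i n * (1 - f i n) * b\<^sup>2"
    if i: "i \<in> {1..k}" for i s b
  proof -
    have "(\<Sum>j=1..k. f j n * (s + (of_bool (j = i) - f i n) * b)\<^sup>2) =
        (\<Sum>j=1..k. (s - f i n * b)\<^sup>2 * f j n + (if j = i then f i n * (2 * s * b + (1 - 2 * f i n) * b\<^sup>2) else 0))"
      by (intro sum.cong) (auto simp: power2_eq_square algebra_simps)
    also have "\<dots> = (s - f i n * b)\<^sup>2 + f i n * (2 * s * b + (1 - 2 * f i n) * b\<^sup>2)"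
      unfolding sum.distrib sum_distrib_left[symmetric] f(2) using i by simp
    finally show ?thesis by (simp add: power2_eq_square algebra_simps)
  qed
  have "(\<Sum>j=1..k. f j n * L j) = (\<Sum>j=1..k. \<Sum>t\<in>T. \<Sum>i=1..k. f j n * (S t i + (of_bool (j = i) - f i n) * a t n)\<^sup>2)"
    by (simp add: L_def sum_distrib_left)
  also have "\<dots> = (\<Sum>t\<in>T. \<Sum>j=1..k. \<Sum>i=1..k. f j n * (S t i + (of_bool (j = i) - f i n) * a t n)\<^sup>2)"
    by (rule sum.swap)
  also have "\<dots> = (\<Sum>t\<in>T. \<Sum>i=1..k. \<Sum>j=1..k. f j n * (S t i + (of_bool (j = i) - f i n) * a t n)\<^sup>2)"
    by (intro sum.cong refl sum.swap)
  also have "\<dots> = (\<Sum>t\<in>T. \<Sum>i=1..k. (S t i)\<^sup>2 + f i n * (1 - f i n) * (a t n)\<^sup>2)"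
    by (intro sum.cong refl mean)
  also have "\<dots> \<le> (\<Sum>t\<in>T. \<Sum>i=1..k. (S t i)\<^sup>2 + f i n * (a t n)\<^sup>2)"
  proof (intro sum_mono add_left_mono mult_right_mono)
    fix i assume "i \<in> {1..k}"
    thus "f i n * (1 - f i n) \<le> f i n" using f(1)[of i n] by (simp add: algebra_simps)
  qed auto
  also have "\<dots> = R"
    unfolding sum.distrib sum_distrib_right[symmetric] f(2) R_def by simp
  finally have avg: "(\<Sum>j=1..k. f j n * L j) \<le> R" .
  have "\<exists>j\<in>{1..k}. L j \<le> R"
  proof (rule ccontr)
    assume "\<not> (\<exists>j\<in>{1..k}. L j \<le> R)"
    hence "(\<Sum>j=1..k. f j n * R) < (\<Sum>j=1..k. f j n * L j)"
      using k f(1) by (intro sum_strict_mono) (auto simp: not_le)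
    moreover have "(\<Sum>j=1..k. f j n * R) = R"
      unfolding sum_distrib_right[symmetric] f(2) by simp
    ultimately show False using avg by simp
  qed
  then obtain j where j: "j \<in> {1..k}" "L j \<le> R" by blast
  have eq: "(\<Sum>v<Suc n. (label_ind (d(n := j)) i v - f i v) * a t v) =
      S t i + (of_bool (j = i) - f i n) * a t n" for i t
  proof -
    have "(\<Sum>v<n. (label_ind (d(n := j)) i v - f i v) * a t v) = S t i"
      unfolding S_def by (intro sum.cong) (auto simp: label_ind_def)
    thus ?thesis by (simp add: label_ind_def)
  qed
  have "(\<Sum>t\<in>T. \<Sum>i=1..k. (\<Sum>v<Suc n. (label_ind (d(n := j)) i v - f i v) * a t v)\<^sup>2) = L j"
    unfolding eq L_def ..
  also note j(2)
  also have "R \<le> (\<Sum>t\<in>T. \<Sum>v<Suc n. (a t v)\<^sup>2)"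
    using IH unfolding R_def S_def by (simp add: sum.distrib)
  finally have "(\<Sum>t\<in>T. \<Sum>i=1..k. (\<Sum>v<Suc n. (label_ind (d(n := j)) i v - f i v) * a t v)\<^sup>2) \<le>
      (\<Sum>t\<in>T. \<Sum>v<Suc n. (a t v)\<^sup>2)" .
  moreover have "d(n := j) ` {..<Suc n} \<subseteq> {1..k}"
    using d j by (auto simp: lessThan_Suc)
  ultimately show ?case by blast
qed

text \<open>Rounding is applied to the n columns and one constant test vector. The latter controls
  the sizes; Cauchy-Schwarz over the columns and \<open>density_form_diff_le\<close> control the
  densities. The hypothesis on \<open>n\<close> makes both errors proportional to \<delta>.\<close>

lemma ex_graph_rounding:
  assumes k: "k \<ge> 1" and f: "\<And>i v. i \<in> {1..k} \<Longrightarrow> f i v > 0" "\<And>v. (\<Sum>i=1..k. f i v) = 1"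
    and \<delta>: "\<delta> > 0" "2 \<le> \<delta>\<^sup>2 * n"
  shows "\<exists>d. d ` {..<n} \<subseteq> {1..k} \<and>
    (\<forall>i\<in>{1..k}. \<bar>real (card {v\<in>{..<n}. d v = i}) - (\<Sum>v<n. f i v)\<bar> \<le> \<delta> * n) \<and>
    (\<forall>i\<in>{1..k}. \<forall>j\<in>{1..k}.
      \<bar>density_form n E (label_ind d) i j - density_form n E f i j\<bar> \<le> 2 * \<delta> * (real n)\<^sup>2)"
proof -
  \<comment> \<open>The index \<open>t = n\<close> is the constant test vector. The factor
    \<open>sqrt n\<close> gives it squared norm n^2, the bound for all columns together, so that one
    total of 2 n^2 suffices for both purposes.\<close>
  define a where "a t v = (if t < n then adj E v t else sqrt n)" for t v
  have "\<exists>d. d ` {..<n} \<subseteq> {1..k} \<and>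
      (\<Sum>t\<le>n. \<Sum>i=1..k. (\<Sum>v<n. (label_ind d i v - f i v) * a t v)\<^sup>2) \<le> (\<Sum>t\<le>n. \<Sum>v<n. (a t v)\<^sup>2)"
    using k f by (rule ex_rounding)
  then obtain d where d_le: "d ` {..<n} \<subseteq> {1..k} \<and>
      (\<Sum>t\<le>n. \<Sum>i=1..k. (\<Sum>v<n. (label_ind d i v - f i v) * a t v)\<^sup>2) \<le> (\<Sum>t\<le>n. \<Sum>v<n. (a t v)\<^sup>2)" ..
  note d = conjunct1[OF d_le] and le = conjunct2[OF d_le]
  define S where "S t i = (\<Sum>v<n. (label_ind d i v - f i v) * a t v)" for t i
  have n: "n > 0" using \<delta> by (cases n) auto
  have "(\<Sum>t\<le>n. \<Sum>v<n. (a t v)\<^sup>2) = (\<Sum>t<n. \<Sum>v<n. (a t v)\<^sup>2) + (\<Sum>v<n. (a n v)\<^sup>2)"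
    by (simp flip: lessThan_Suc_atMost)
  also have "\<dots> \<le> (\<Sum>t<n. \<Sum>v<n. 1) + (\<Sum>v<n. real n)"
    by (intro add_mono sum_mono) (auto simp: a_def adj_def)
  also have "\<dots> = 2 * (real n)\<^sup>2" by (simp add: power2_eq_square)
  finally have tot: "(\<Sum>t\<le>n. \<Sum>i=1..k. (S t i)\<^sup>2) \<le> 2 * (real n)\<^sup>2"
    using le by (simp add: S_def)
  have one: "(\<Sum>t\<le>n. (S t i)\<^sup>2) \<le> 2 * (real n)\<^sup>2" if "i \<in> {1..k}" for i
  proof -
    have "(\<Sum>t\<le>n. (S t i)\<^sup>2) \<le> (\<Sum>t\<le>n. \<Sum>i=1..k. (S t i)\<^sup>2)"
      using that by (intro sum_mono member_le_sum) auto
    thus ?thesis using tot by simp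
  qed
  have size: "\<bar>real (card {v\<in>{..<n}. d v = i}) - (\<Sum>v<n. f i v)\<bar> \<le> \<delta> * n" if i: "i \<in> {1..k}" for i
  proof -
    define D where "D = real (card {v\<in>{..<n}. d v = i}) - (\<Sum>v<n. f i v)"
    have "D = (\<Sum>v<n. label_ind d i v - f i v)"
      by (simp add: D_def sum_label_ind sum_subtractf)
    hence "S n i = sqrt n * D"
      by (simp add: S_def a_def mult.commute sum_distrib_left)
    hence "real n * D\<^sup>2 = (S n i)\<^sup>2" by (simp add: power_mult_distrib)
    also have "\<dots> \<le> (\<Sum>t\<le>n. (S t i)\<^sup>2)" by (intro member_le_sum) auto
    also have "\<dots> \<le> 2 * (real n)\<^sup>2" by (rule one[OF i])
    finally have "D\<^sup>2 \<le> 2 * real n" using n by (simp add: power2_eq_square)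
    also have "\<dots> \<le> \<delta>\<^sup>2 * n * n" using \<delta> by (intro mult_right_mono) auto
    also have "\<dots> = (\<delta> * n)\<^sup>2" by (simp add: power2_eq_square)
    finally show ?thesis unfolding D_def[symmetric]
      using \<delta> abs_le_square_iff[of D "\<delta> * n"] by simp
  qed
  have cols: "(\<Sum>u<n. \<bar>\<Sum>v<n. (label_ind d i v - f i v) * adj E v u\<bar>) \<le> \<delta> * (real n)\<^sup>2"
    if i: "i \<in> {1..k}" for i
  proof -
    have eq: "(\<Sum>u<n. \<bar>\<Sum>v<n. (label_ind d i v - f i v) * adj E v u\<bar>) = (\<Sum>u<n. \<bar>S u i\<bar>)"
      by (intro sum.cong) (auto simp: S_def a_def)
    have "(\<Sum>u<n. \<bar>S u i\<bar>)\<^sup>2 \<le> real n * (\<Sum>u<n. (S u i)\<^sup>2)"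
      using sum_squared_le_sum_of_squares[where I = "{..<n}" and f = "\<lambda>u. \<bar>S u i\<bar>"] by (simp add: mult.commute)
    also have "\<dots> \<le> real n * (\<Sum>u\<le>n. (S u i)\<^sup>2)"
      by (intro mult_left_mono sum_mono2) auto
    also have "\<dots> \<le> real n * (2 * (real n)\<^sup>2)" by (intro mult_left_mono one i) auto
    also have "\<dots> \<le> real n * (\<delta>\<^sup>2 * n * (real n)\<^sup>2)"
      using \<delta> by (intro mult_left_mono mult_right_mono) auto
    also have "\<dots> = (\<delta> * (real n)\<^sup>2)\<^sup>2" by (simp add: power2_eq_square)
    finally have "(\<Sum>u<n. \<bar>S u i\<bar>)\<^sup>2 \<le> (\<delta> * (real n)\<^sup>2)\<^sup>2" .
    thus ?thesis unfolding eq using \<delta> by (intro power2_le_imp_le[of "\<Sum>u<n. \<bar>S u i\<bar>"]) auto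
  qed
  have f01: "f i v \<in> {0..1}" if i: "i \<in> {1..k}" for i v
  proof -
    have "f i v \<le> (\<Sum>i=1..k. f i v)"
      using i less_imp_le[OF f(1)] by (intro member_le_sum[of i _ "\<lambda>i. f i v"]) simp_all
    also have "\<dots> = 1" by (rule f(2))
    finally show ?thesis using f(1)[OF i, of v] by simp
  qed
  have "\<bar>density_form n E (label_ind d) i j - density_form n E f i j\<bar> \<le> 2 * \<delta> * (real n)\<^sup>2"
    if ij: "i \<in> {1..k}" "j \<in> {1..k}" for i j
  proof -
    have "\<bar>density_form n E (label_ind d) i j - density_form n E f i j\<bar> \<le>
      (\<Sum>u<n. \<bar>\<Sum>v<n. (label_ind d i v - f i v) * adj E v u\<bar>) +
      (\<Sum>u<n. \<bar>\<Sum>v<n. (label_ind d j v - f j v) * adj E v u\<bar>)"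
    proof (rule density_form_diff_le)
      show "f i v \<in> {0..1}" for v by (rule f01[OF ij(1)])
    qed simp
    also have "\<dots> \<le> \<delta> * (real n)\<^sup>2 + \<delta> * (real n)\<^sup>2"
      by (rule add_mono[OF cols[OF ij(1)] cols[OF ij(2)]])
    also have "\<dots> = 2 * \<delta> * (real n)\<^sup>2" by simp
    finally show ?thesis .
  qed
  thus ?thesis using d size by (intro exI[of _ d] conjI ballI)
qed

section \<open>Adjusting the part sizes of a labelling\<close>

lemma sum_card_fibres:
  fixes d :: "nat \<Rightarrow> nat"
  assumes "d ` {..<n} \<subseteq> {1..k}"
  shows "(\<Sum>i=1..k. card {v\<in>{..<n}. d v = i}) = n"
proof -
  have "(\<Sum>i=1..k. card {v\<in>{..<n}. d v = i}) = card (\<Union>i\<in>{1..k}. {v\<in>{..<n}. d v = i})"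
    by (intro card_UN_disjoint[symmetric]) auto
  also have "(\<Union>i\<in>{1..k}. {v\<in>{..<n}. d v = i}) = {..<n}"
    using assms by auto
  finally show ?thesis by simp
qed

text \<open>Truncated subtraction makes the sum the total surplus of the overfull parts. Both size
  vectors add up to \<open>n\<close>, so an overfull part coexists with an underfull one, and moving
  a vertex between them lowers the surplus by exactly one.\<close>

lemma ex_relabelling:
  fixes d :: "nat \<Rightarrow> nat"
  assumes "d ` {..<n} \<subseteq> {1..k}" and "(\<Sum>i=1..k. z i) = n"
  shows "\<exists>d'. d' ` {..<n} \<subseteq> {1..k} \<and> (\<forall>i\<in>{1..k}. card {v\<in>{..<n}. d' v = i} = z i) \<and>
    card {v\<in>{..<n}. d v \<noteq> d' v} \<le> (\<Sum>i=1..k. card {v\<in>{..<n}. d v = i} - z i)"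
  using assms(1)
proof (induction "\<Sum>i=1..k. card {v\<in>{..<n}. d v = i} - z i" arbitrary: d)
  case 0
  have le: "card {v\<in>{..<n}. d v = i} \<le> z i" if "i \<in> {1..k}" for i
    using 0(1) that by simp
  have "card {v\<in>{..<n}. d v = i} = z i" if i: "i \<in> {1..k}" for i
  proof (rule ccontr)
    assume "card {v\<in>{..<n}. d v = i} \<noteq> z i"
    hence "\<exists>i\<in>{1..k}. card {v\<in>{..<n}. d v = i} < z i"
      using le[OF i] i by (intro bexI[of _ i]) (simp_all only: order_less_le simp_thms)
    hence "(\<Sum>i=1..k. card {v\<in>{..<n}. d v = i}) < (\<Sum>i=1..k. z i)"
      using le by (intro sum_strict_mono_ex1) blast+
    thus False using sum_card_fibres[OF 0(2)] assms(2) by simp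
  qed
  thus ?case using 0 by (intro exI[of _ d]) auto
next
  case (Suc N)
  define F where "F d i = {v\<in>{..<n}. d v = i}" for d :: "nat \<Rightarrow> nat" and i
  have N: "Suc N = (\<Sum>i=1..k. card (F d i) - z i)" using Suc(2) by (simp add: F_def)
  obtain i where i: "i \<in> {1..k}" "card (F d i) > z i"
  proof -
    have "\<not> (\<forall>i\<in>{1..k}. card (F d i) - z i = 0)"
    proof
      assume "\<forall>i\<in>{1..k}. card (F d i) - z i = 0"
      hence "(\<Sum>i=1..k. card (F d i) - z i) = 0" by (intro sum.neutral)
      thus False using N by simp
    qed
    then obtain i where "i \<in> {1..k}" "card (F d i) - z i \<noteq> 0" by blast
    thus ?thesis using that[of i] by simp
  qed
  have "\<exists>j\<in>{1..k}. card (F d j) < z j"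
  proof (rule ccontr)
    assume "\<not> (\<exists>j\<in>{1..k}. card (F d j) < z j)"
    hence "\<forall>j\<in>{1..k}. z j \<le> card (F d j)" by (simp add: not_less)
    hence "(\<Sum>i=1..k. z i) < (\<Sum>i=1..k. card (F d i))"
      using i by (intro sum_strict_mono_ex1) blast+
    thus False using sum_card_fibres[OF Suc(3)] assms(2) by (simp add: F_def)
  qed
  then obtain j where j: "j \<in> {1..k}" "card (F d j) < z j" by blast
  have "i \<noteq> j" using i j by auto
  have fin: "finite (F d' l)" for d' l by (auto simp: F_def)
  obtain v where v: "v \<in> F d i" using i(2) by (metis card.empty ex_in_conv not_less_zero)
  define e where "e = d(v := j)"
  have Fe: "F e l = (if l = i then F d i - {v} else if l = j then insert v (F d j) else F d l)" for l
    using v \<open>i \<noteq> j\<close> by (auto simp: F_def e_def)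
  have vj: "v \<notin> F d j" using v \<open>i \<noteq> j\<close> by (auto simp: F_def)
  have step: "card (F e l) - z l = (card (F d l) - z l) - (if l = i then 1 else 0)" for l
    using v vj i j fin \<open>i \<noteq> j\<close> by (auto simp: Fe)
  have "(\<Sum>l=1..k. card (F e l) - z l) + 1 = (\<Sum>l=1..k. card (F d l) - z l)"
  proof -
    have "(\<Sum>l=1..k. card (F d l) - z l) = (\<Sum>l=1..k. (card (F e l) - z l) + (if l = i then 1 else 0))"
      using i by (intro sum.cong) (auto simp: step)
    thus ?thesis using i by (simp add: sum.distrib)
  qed
  hence N': "N = (\<Sum>l=1..k. card (F e l) - z l)" using N by simp
  have e: "e ` {..<n} \<subseteq> {1..k}" using Suc(3) j by (auto simp: e_def)
  obtain d' where d': "d' ` {..<n} \<subseteq> {1..k}" "\<forall>i\<in>{1..k}. card (F d' i) = z i"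
    "card {v\<in>{..<n}. e v \<noteq> d' v} \<le> N"
    using Suc(1)[of e, folded F_def, OF N' e] N' unfolding F_def by auto
  have "card {v\<in>{..<n}. d v \<noteq> d' v} \<le> card (insert v {v\<in>{..<n}. e v \<noteq> d' v})"
    by (intro card_mono) (auto simp: e_def)
  also have "\<dots> \<le> Suc N" using d'(3) by (simp add: card_insert_if)
  finally show ?case using d' N by (intro exI[of _ d']) (auto simp: F_def)
qed

text \<open>Each relabelled vertex alters each of the n column inner products by at most 1, in
  either argument.\<close>

lemma density_form_relabel_le:
  "\<bar>density_form n E (label_ind d) i j - density_form n E (label_ind d') i j\<bar> \<le>
    2 * n * real (card {v\<in>{..<n}. d v \<noteq> d' v})"
proof -
  have *: "(\<Sum>u<n. \<bar>\<Sum>v<n. (label_ind d l v - label_ind d' l v) * adj E v u\<bar>) \<le>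
      n * real (card {v\<in>{..<n}. d v \<noteq> d' v})" for l
  proof -
    have "(\<Sum>u<n. \<bar>\<Sum>v<n. (label_ind d l v - label_ind d' l v) * adj E v u\<bar>) \<le>
        (\<Sum>u<n. \<Sum>v<n. of_bool (d v \<noteq> d' v))"
    proof (intro sum_mono order_trans[OF sum_abs])
      fix u v
      show "\<bar>(label_ind d l v - label_ind d' l v) * adj E v u\<bar> \<le> of_bool (d v \<noteq> d' v)"
        by (auto simp: label_ind_def adj_def)
    qed
    also have "\<dots> = n * real (card {v\<in>{..<n}. d v \<noteq> d' v})"
      by (simp add: of_bool_def sum.If_cases Int_def)
    finally show ?thesis .
  qed
  have "\<bar>density_form n E (label_ind d) i j - density_form n E (label_ind d') i j\<bar> \<le>
    (\<Sum>u<n. \<bar>\<Sum>v<n. (label_ind d i v - label_ind d' i v) * adj E v u\<bar>) +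
    (\<Sum>u<n. \<bar>\<Sum>v<n. (label_ind d j v - label_ind d' j v) * adj E v u\<bar>)"
    by (rule density_form_diff_le) simp_all
  also have "\<dots> \<le> n * real (card {v\<in>{..<n}. d v \<noteq> d' v}) + n * real (card {v\<in>{..<n}. d v \<noteq> d' v})"
    by (rule add_mono[OF * *])
  also have "\<dots> = 2 * real n * real (card {v\<in>{..<n}. d v \<noteq> d' v})" by simp
  finally show ?thesis .
qed

section \<open>Distance to the property in terms of labellings\<close>

definition fibre :: "nat \<Rightarrow> (nat \<Rightarrow> nat) \<Rightarrow> nat \<Rightarrow> nat set" where
  "fibre n c i = {v\<in>{..<n}. c v = i}"

text \<open>Indexing by the image set makes the classes disjoint without choosing an order of the
  labels; edges inside a part have a singleton index.\<close>

definition edge_class :: "edges \<Rightarrow> (nat \<Rightarrow> nat) \<Rightarrow> nat set \<Rightarrow> edges" where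
  "edge_class E c s = {e\<in>E. c ` e = s}"

abbreviation complete_edges :: "nat \<Rightarrow> edges" where
  "complete_edges n \<equiv> {{u, v} |u v. u < n \<and> v < n \<and> u \<noteq> v}"

lemma finite_complete_edges: "finite (complete_edges n)"
proof (rule finite_subset)
  show "complete_edges n \<subseteq> Pow {..<n}" by auto
qed auto

lemma graph_finite: "graph n E \<Longrightarrow> finite E"
  unfolding graph_def using finite_complete_edges finite_subset by blast

lemma edges_between_fibre:
  assumes "graph n E"
  shows "edges_between E (fibre n c i) (fibre n c j) = edge_class E c {i, j}"
proof (intro equalityI subsetI)
  fix e assume "e \<in> edges_between E (fibre n c i) (fibre n c j)"
  thus "e \<in> edge_class E c {i, j}"
    by (auto simp: edges_between_def fibre_def edge_class_def)
next
  fix e assume e: "e \<in> edge_class E c {i, j}"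
  then obtain u v where uv: "e = {u, v}" "u < n" "v < n"
    using assms by (auto simp: graph_def edge_class_def)
  have "{c u, c v} = {i, j}" using e uv by (simp add: edge_class_def)
  hence "c u = i \<and> c v = j \<or> c u = j \<and> c v = i" by (simp add: doubleton_eq_iff)
  thus "e \<in> edges_between E (fibre n c i) (fibre n c j)"
    using e uv unfolding edges_between_def fibre_def edge_class_def
    by (auto simp: insert_commute)
qed

lemma card_ordered_edges:
  assumes "graph n E"
  shows "card {(u, v). {u, v} \<in> E} = 2 * card E"
proof -
  have fib: "finite {(u, v). {u, v} = e} \<and> card {(u, v). {u, v} = e} = 2" if "e \<in> E" for e
  proof -
    have "e \<in> complete_edges n" using assms \<open>e \<in> E\<close> unfolding graph_def by blast
    then obtain u v where "e = {u, v}" "u \<noteq> v" by blast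
    hence "{(u, v). {u, v} = e} = {(u, v), (v, u)}" by (auto simp: doubleton_eq_iff)
    thus ?thesis using \<open>u \<noteq> v\<close> by simp
  qed
  have "{(u, v). {u, v} \<in> E} = (\<Union>e\<in>E. {(u, v). {u, v} = e})" by auto
  also have "card \<dots> = (\<Sum>e\<in>E. card {(u, v). {u, v} = e})"
    using fib graph_finite[OF assms] by (intro card_UN_disjoint) auto
  also have "\<dots> = 2 * card E" using fib by simp
  finally show ?thesis .
qed

text \<open>The ordered versions of the edges in the class are \<open>P i j \<union> P j i\<close>.
  These two sets coincide for \<open>i = j\<close>, and are disjoint and equally large
  otherwise.\<close>

lemma density_form_label_ind:
  assumes "graph n E"
  shows "density_form n E (label_ind c) i j = (if i = j then 2 else 1) * real (card (edge_class E c {i, j}))"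
proof -
  define P where "P i j = {(u, v). {u, v} \<in> E \<and> c u = i \<and> c v = j}" for i j
  have lt: "u < n \<and> v < n" if "{u, v} \<in> E" for u v
    using assms that by (auto simp: graph_def doubleton_eq_iff)
  have fin: "finite (P i j)" for i j
    by (rule finite_subset[of _ "{..<n} \<times> {..<n}"]) (auto simp: P_def dest: lt)
  have "density_form n E (label_ind c) i j =
      (\<Sum>z\<in>{..<n} \<times> {..<n}. of_bool (z \<in> P i j))"
    unfolding density_form_def sum.cartesian_product
    by (intro sum.cong) (auto simp: adj_def label_ind_def P_def)
  also have "\<dots> = real (card (({..<n} \<times> {..<n}) \<inter> P i j))"
    by (simp add: of_bool_def sum.If_cases Int_def)
  also have "({..<n} \<times> {..<n}) \<inter> P i j = P i j" by (auto simp: P_def dest: lt)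
  finally have M: "density_form n E (label_ind c) i j = real (card (P i j))" .
  have "graph n (edge_class E c {i, j})"
    using assms by (auto simp: graph_def edge_class_def)
  hence "2 * card (edge_class E c {i, j}) = card {(u, v). {u, v} \<in> edge_class E c {i, j}}"
    by (simp add: card_ordered_edges)
  also have "{(u, v). {u, v} \<in> edge_class E c {i, j}} = P i j \<union> P j i"
    by (auto simp: edge_class_def P_def doubleton_eq_iff)
  finally have two: "2 * card (edge_class E c {i, j}) = card (P i j \<union> P j i)" .
  show ?thesis
  proof (cases "i = j")
    case True
    thus ?thesis using M two by simp
  next
    case False
    have "card (P i j) = card (P j i)"
      by (rule bij_betw_same_card[of prod.swap])
         (auto simp: P_def bij_betw_def inj_on_def image_iff insert_commute)
    moreover have "card (P i j \<union> P j i) = card (P i j) + card (P j i)"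
      using fin False by (intro card_Un_disjoint) (auto simp: P_def)
    ultimately show ?thesis using M two False by simp
  qed
qed

section \<open>Edge counts indexed by unordered pairs of labels\<close>

definition label_pairs :: "nat \<Rightarrow> nat set set" where
  "label_pairs k = (\<lambda>(i, j). {i, j}) ` ({1..k} \<times> {1..k})"

lemma finite_label_pairs [simp]: "finite (label_pairs k)"
  by (simp add: label_pairs_def)

text \<open>A two-element set arises from two ordered pairs and a singleton from one, for which the
  weight 2 compensates.\<close>

lemma sum_label_pairs:
  fixes h :: "nat set \<Rightarrow> real"
  shows "(\<Sum>i=1..k. \<Sum>j=1..k. (if i = j then 2 else 1) * h {i, j}) = 2 * (\<Sum>s\<in>label_pairs k. h s)"
proof -
  define P where "P = {1..k} \<times> {1..k}"
  define g where "g = (\<lambda>(i, j). (if i = j then 2 else 1) * h {i, j})"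
  have "(\<Sum>i=1..k. \<Sum>j=1..k. (if i = j then 2 else 1) * h {i, j}) = (\<Sum>p\<in>P. g p)"
    by (simp add: P_def g_def sum.cartesian_product)
  also have "\<dots> = (\<Sum>s\<in>label_pairs k. \<Sum>p\<in>{p\<in>P. (\<lambda>(i, j). {i, j}) p = s}. g p)"
    by (intro sum.group[symmetric]) (auto simp: P_def label_pairs_def)
  also have "\<dots> = (\<Sum>s\<in>label_pairs k. 2 * h s)"
  proof (intro sum.cong refl)
    fix s assume "s \<in> label_pairs k"
    then obtain i j where ij: "i \<in> {1..k}" "j \<in> {1..k}" "s = {i, j}" by (auto simp: label_pairs_def)
    have "{p\<in>P. (\<lambda>(i, j). {i, j}) p = s} = {(i, j), (j, i)}"
    proof (intro equalityI subsetI)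
      fix p assume "p \<in> {p\<in>P. (\<lambda>(i, j). {i, j}) p = s}"
      hence "{fst p, snd p} = {i, j}" using ij(3) by (simp add: case_prod_unfold)
      hence "fst p = i \<and> snd p = j \<or> fst p = j \<and> snd p = i" by (simp only: doubleton_eq_iff)
      thus "p \<in> {(i, j), (j, i)}" by (cases p) simp
    next
      fix p assume "p \<in> {(i, j), (j, i)}"
      thus "p \<in> {p\<in>P. (\<lambda>(i, j). {i, j}) p = s}"
        using ij by (elim insertE) (simp_all add: P_def insert_commute)
    qed
    thus "(\<Sum>p\<in>{p\<in>P. (\<lambda>(i, j). {i, j}) p = s}. g p) = 2 * h s"
      using ij(3) by (cases "i = j") (simp_all add: g_def insert_commute[of j i])
  qed
  finally show ?thesis by (simp add: sum_distrib_left)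
qed

lemma sum_density_form_diff:
  assumes "graph n E" "graph n E'"
  shows "(\<Sum>i=1..k. \<Sum>j=1..k. \<bar>density_form n E (label_ind c) i j - density_form n E' (label_ind c') i j\<bar>) =
    2 * (\<Sum>s\<in>label_pairs k. \<bar>real (card (edge_class E c s)) - real (card (edge_class E' c' s))\<bar>)"
proof -
  define h where "h s = \<bar>real (card (edge_class E c s)) - real (card (edge_class E' c' s))\<bar>" for s
  have "(\<Sum>i=1..k. \<Sum>j=1..k. \<bar>density_form n E (label_ind c) i j - density_form n E' (label_ind c') i j\<bar>) =
    (\<Sum>i=1..k. \<Sum>j=1..k. (if i = j then 2 else 1) * h {i, j})"
    by (intro sum.cong refl) (auto simp: h_def density_form_label_ind[OF assms(1)] density_form_label_ind[OF assms(2)] abs_if)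
  also have "\<dots> = 2 * (\<Sum>s\<in>label_pairs k. h s)" by (rule sum_label_pairs)
  finally show ?thesis unfolding h_def .
qed

lemma card_edge_classes:
  assumes "graph n E" "c ` {..<n} \<subseteq> {1..k}"
  shows "(\<Sum>s\<in>label_pairs k. card (edge_class E c s)) = card E"
proof -
  have "(\<Sum>s\<in>label_pairs k. card (edge_class E c s)) = (\<Sum>s\<in>label_pairs k. \<Sum>e\<in>{e\<in>E. c ` e = s}. 1)"
    by (simp add: edge_class_def)
  also have "\<dots> = (\<Sum>e\<in>E. 1)"
  proof (intro sum.group graph_finite[OF assms(1)])
    show "(`) c ` E \<subseteq> label_pairs k"
    proof
      fix s assume "s \<in> (`) c ` E"
      then obtain u v where "s = {c u, c v}" "u < n" "v < n"
        using assms(1) by (auto simp: graph_def)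
      thus "s \<in> label_pairs k" using assms(2)
        unfolding label_pairs_def by (intro image_eqI[of _ _ "(c u, c v)"]) auto
    qed
  qed auto
  finally show ?thesis by simp
qed

lemma card_diff_le:
  assumes "finite A" "finite B"
  shows "\<bar>real (card A) - real (card B)\<bar> \<le> real (card (A - B)) + real (card (B - A))"
proof -
  have "card A = card (A \<inter> B) + card (A - B)" "card B = card (A \<inter> B) + card (B - A)"
    by (rule card_Int_Diff[OF assms(1)], subst Int_commute, rule card_Int_Diff[OF assms(2)])
  thus ?thesis by linarith
qed

text \<open>The lower bound on the edit distance: within each class, at least the difference of the
  two edge counts must be edited.\<close>

lemma density_form_diff_le_graph_dist:
  assumes E: "graph n E" "graph n E'" and c: "c ` {..<n} \<subseteq> {1..k}"
  shows "(\<Sum>i=1..k. \<Sum>j=1..k. \<bar>density_form n E (label_ind c) i j - density_form n E' (label_ind c) i j\<bar>) / 2 / (real n)\<^sup>2 \<le>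
    graph_dist n E E'"
proof -
  have gr: "graph n (E - E')" "graph n (E' - E)" using E by (auto simp: graph_def)
  have "(\<Sum>i=1..k. \<Sum>j=1..k. \<bar>density_form n E (label_ind c) i j - density_form n E' (label_ind c) i j\<bar>) / 2 =
    (\<Sum>s\<in>label_pairs k. \<bar>real (card (edge_class E c s)) - real (card (edge_class E' c s))\<bar>)"
    by (simp only: sum_density_form_diff[OF E])
  also have "\<dots> \<le> (\<Sum>s\<in>label_pairs k. real (card (edge_class (E - E') c s)) + real (card (edge_class (E' - E) c s)))"
  proof (intro sum_mono)
    fix s
    have "finite (edge_class E c s)" "finite (edge_class E' c s)"
      using graph_finite E by (auto simp: edge_class_def)
    moreover have "edge_class E c s - edge_class E' c s = edge_class (E - E') c s"
      "edge_class E' c s - edge_class E c s = edge_class (E' - E) c s"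
      by (auto simp: edge_class_def)
    ultimately show "\<bar>real (card (edge_class E c s)) - real (card (edge_class E' c s))\<bar> \<le>
        real (card (edge_class (E - E') c s)) + real (card (edge_class (E' - E) c s))"
      using card_diff_le[of "edge_class E c s" "edge_class E' c s"] by simp
  qed
  also have "\<dots> = real (card (E - E')) + real (card (E' - E))"
    using card_edge_classes[OF gr(1) c] card_edge_classes[OF gr(2) c]
    by (simp add: sum.distrib flip: of_nat_sum)
  finally show ?thesis unfolding graph_dist_def by (rule divide_right_mono) simp
qed

section \<open>Editing a graph inside the classes of a labelling\<close>

lemma graph_complete: "graph n (complete_edges n)"
  by (simp add: graph_def)

lemma density_form_complete:
  "density_form n (complete_edges n) (label_ind c) i j =
    real (card (fibre n c i)) * real (card (fibre n c j)) - (if i = j then real (card (fibre n c i)) else 0)"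
proof -
  have "density_form n (complete_edges n) (label_ind c) i j =
      (\<Sum>u<n. \<Sum>v<n. label_ind c i u * label_ind c j v - (if v = u then label_ind c i u * label_ind c j u else 0))"
    unfolding density_form_def
    by (intro sum.cong refl) (auto simp: adj_def doubleton_eq_iff)
  also have "\<dots> = (\<Sum>u<n. label_ind c i u) * (\<Sum>v<n. label_ind c j v) - (\<Sum>u<n. label_ind c i u * label_ind c j u)"
    by (simp add: sum_subtractf sum_product)
  also have "(\<Sum>u<n. label_ind c i u * label_ind c j u) = (if i = j then (\<Sum>u<n. label_ind c i u) else 0)"
    by (auto simp: label_ind_def intro!: sum.cong sum.neutral)
  finally show ?thesis by (simp add: sum_label_ind fibre_def)
qed

text \<open>The capacity of a class is determined by the part sizes, by
  \<open>density_form_complete\<close>. Hence edge counts realised under \<open>c'\<close> also fit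
  into the classes of \<open>c\<close>.\<close>

lemma card_edge_class_complete_cong:
  assumes "\<And>i. i \<in> {1..k} \<Longrightarrow> card (fibre n c i) = card (fibre n c' i)" "s \<in> label_pairs k"
  shows "card (edge_class (complete_edges n) c s) = card (edge_class (complete_edges n) c' s)"
proof -
  obtain i j where ij: "i \<in> {1..k}" "j \<in> {1..k}" "s = {i, j}" using assms(2) by (auto simp: label_pairs_def)
  have "density_form n (complete_edges n) (label_ind c) i j = density_form n (complete_edges n) (label_ind c') i j"
    using ij assms(1) by (simp only: density_form_complete)
  thus ?thesis using ij by (simp only: density_form_label_ind[OF graph_complete]) (simp split: if_splits)
qed

text \<open>If \<open>A\<close> is too large, only delete; if it is too small, only insert elements
  of \<open>K\<close>. Either way one of the two differences is empty.\<close>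

lemma ex_edit_within:
  assumes "finite K" "A \<subseteq> K" "b \<le> card K"
  shows "\<exists>X. X \<subseteq> K \<and> card X = b \<and>
    real (card (A - X)) + real (card (X - A)) = \<bar>real (card A) - real b\<bar>"
proof (cases "b \<le> card A")
  case True
  then obtain X where X: "X \<subseteq> A" "card X = b" by (meson obtain_subset_with_card_n)
  have "finite A" using assms finite_subset by blast
  hence "card (A - X) = card A - b" using X by (simp add: card_Diff_subset finite_subset)
  moreover have "card (X - A) = 0" using X by (simp add: Diff_eq_empty_iff[THEN iffD2])
  ultimately show ?thesis using X assms True by (intro exI[of _ X]) auto
next
  case False
  have finA: "finite A" using assms finite_subset by blast
  have "b - card A \<le> card (K - A)" using assms finA by (simp add: card_Diff_subset)
  then obtain Y where Y: "Y \<subseteq> K - A" "card Y = b - card A" by (meson obtain_subset_with_card_n)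
  have finY: "finite Y" using Y assms by (meson finite_Diff finite_subset)
  have "card (A \<union> Y) = card A + card Y"
    using Y finA finY by (intro card_Un_disjoint) auto
  moreover have "card (A - (A \<union> Y)) = 0" "A \<union> Y - A = Y"
    using Y by (auto simp: Diff_eq_empty_iff[THEN iffD2])
  ultimately show ?thesis using Y assms False by (intro exI[of _ "A \<union> Y"]) auto
qed

text \<open>The lower bound on the edit distance is attained by editing every class separately with
  \<open>ex_edit_within\<close>; equal part sizes guarantee sufficient capacity.\<close>

lemma ex_edited_graph:
  assumes E: "graph n E" "graph n E'" and c: "c ` {..<n} \<subseteq> {1..k}"
    and sizes: "\<And>i. i \<in> {1..k} \<Longrightarrow> card (fibre n c i) = card (fibre n c' i)"
  shows "\<exists>E''. graph n E'' \<and>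
    (\<forall>s\<in>label_pairs k. card (edge_class E'' c s) = card (edge_class E' c' s)) \<and>
    graph_dist n E E'' = (\<Sum>i=1..k. \<Sum>j=1..k.
      \<bar>density_form n E (label_ind c) i j - density_form n E' (label_ind c') i j\<bar>) / 2 / (real n)\<^sup>2"
proof -
  define K where "K s = edge_class (complete_edges n) c s" for s
  have ex: "\<exists>X. X \<subseteq> K s \<and> card X = card (edge_class E' c' s) \<and>
     real (card (edge_class E c s - X)) + real (card (X - edge_class E c s)) =
       \<bar>real (card (edge_class E c s)) - real (card (edge_class E' c' s))\<bar>" if s: "s \<in> label_pairs k" for s
  proof (rule ex_edit_within)
    show "finite (K s)" using finite_complete_edges by (simp add: K_def edge_class_def)
    show "edge_class E c s \<subseteq> K s" using E(1) by (auto simp: graph_def K_def edge_class_def)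
    have "card (edge_class E' c' s) \<le> card (edge_class (complete_edges n) c' s)"
      using E(2) finite_complete_edges by (intro card_mono) (auto simp: graph_def edge_class_def)
    thus "card (edge_class E' c' s) \<le> card (K s)"
      using card_edge_class_complete_cong[OF sizes s] by (simp add: K_def)
  qed
  hence "\<exists>X. \<forall>s\<in>label_pairs k. X s \<subseteq> K s \<and> card (X s) = card (edge_class E' c' s) \<and>
     real (card (edge_class E c s - X s)) + real (card (X s - edge_class E c s)) =
       \<bar>real (card (edge_class E c s)) - real (card (edge_class E' c' s))\<bar>"
    by (intro bchoice ballI)
  then obtain X where XX: "\<forall>s\<in>label_pairs k. X s \<subseteq> K s \<and> card (X s) = card (edge_class E' c' s) \<and>
     real (card (edge_class E c s - X s)) + real (card (X s - edge_class E c s)) =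
       \<bar>real (card (edge_class E c s)) - real (card (edge_class E' c' s))\<bar>" ..
  note X = conjunct1[OF bspec[OF XX]] conjunct1[OF conjunct2[OF bspec[OF XX]]]
    conjunct2[OF conjunct2[OF bspec[OF XX]]]
  define E'' where "E'' = (\<Union>s\<in>label_pairs k. X s)"
  have gr: "graph n E''"
    unfolding graph_def E''_def using X(1) by (intro UN_least) (force simp: K_def edge_class_def)
  \<comment> \<open>The replacement \<open>X s\<close> stays inside the class of \<open>s\<close>,
    so the union over all \<open>s\<close> has exactly these sets as its classes.\<close>
  have key: "c ` e = s" if "s \<in> label_pairs k" "e \<in> X s" for s e
    using X(1)[OF that(1)] that(2) by (auto simp: K_def edge_class_def)
  have cls: "edge_class E'' c s = X s" if s: "s \<in> label_pairs k" for s
  proof (intro equalityI subsetI)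
    fix e assume "e \<in> edge_class E'' c s"
    then obtain s' where "s' \<in> label_pairs k" "e \<in> X s'" "c ` e = s"
      by (auto simp: E''_def edge_class_def)
    thus "e \<in> X s" using key by blast
  qed (use s key in \<open>auto simp: E''_def edge_class_def\<close>)
  have gr2: "graph n (E - E'')" "graph n (E'' - E)" using E gr by (auto simp: graph_def)
  have "real (card (E - E'')) + real (card (E'' - E)) =
      (\<Sum>s\<in>label_pairs k. real (card (edge_class (E - E'') c s)) + real (card (edge_class (E'' - E) c s)))"
    using card_edge_classes[OF gr2(1) c] card_edge_classes[OF gr2(2) c]
    by (simp add: sum.distrib flip: of_nat_sum)
  also have "\<dots> = (\<Sum>s\<in>label_pairs k. \<bar>real (card (edge_class E c s)) - real (card (edge_class E' c' s))\<bar>)"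
  proof (intro sum.cong refl)
    fix s assume s: "s \<in> label_pairs k"
    have "edge_class (E - E'') c s = edge_class E c s - X s" "edge_class (E'' - E) c s = X s - edge_class E c s"
      unfolding cls[OF s, symmetric] by (auto simp: edge_class_def)
    thus "real (card (edge_class (E - E'') c s)) + real (card (edge_class (E'' - E) c s)) =
      \<bar>real (card (edge_class E c s)) - real (card (edge_class E' c' s))\<bar>" using X(3)[OF s] by simp
  qed
  also have "\<dots> = (\<Sum>i=1..k. \<Sum>j=1..k.
      \<bar>density_form n E (label_ind c) i j - density_form n E' (label_ind c') i j\<bar>) / 2"
    by (simp only: sum_density_form_diff[OF E])
  finally have "graph_dist n E E'' = (\<Sum>i=1..k. \<Sum>j=1..k.
      \<bar>density_form n E (label_ind c) i j - density_form n E' (label_ind c') i j\<bar>) / 2 / (real n)\<^sup>2"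
    by (simp only: graph_dist_def)
  moreover have "\<forall>s\<in>label_pairs k. card (edge_class E'' c s) = card (edge_class E' c' s)"
    by (intro ballI) (simp only: cls X(2))
  ultimately show ?thesis using gr by (intro exI[of _ E''] conjI)
qed

text \<open>A vertex partition is encoded by the labelling that it is the fibre family of.\<close>

definition witness :: "nat \<Rightarrow> partition_description \<Rightarrow> nat \<Rightarrow> edges \<Rightarrow> (nat \<Rightarrow> nat) \<Rightarrow> bool" where
  "witness k \<Phi> n E c \<longleftrightarrow> graph n E \<and> c ` {..<n} \<subseteq> {1..k} \<and> satisfies k \<Phi> n E (fibre n c)"

lemma partition_property_witness:
  "(n, E) \<in> partition_property k \<Phi> \<longleftrightarrow> (\<exists>c. witness k \<Phi> n E c)"
proof
  assume "(n, E) \<in> partition_property k \<Phi>"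
  then obtain V where V: "graph n E" "vertex_partition k n V" "satisfies k \<Phi> n E V"
    by (auto simp: partition_property_def)
  hence U: "(\<Union>i\<in>{1..k}. V i) = {..<n}" and disj: "disjoint_family_on V {1..k}"
    by (auto simp: vertex_partition_def)
  have "\<exists>i. i \<in> {1..k} \<and> v \<in> V i" if "v < n" for v
    using that U by blast
  then obtain c where c: "\<And>v. v < n \<Longrightarrow> c v \<in> {1..k} \<and> v \<in> V (c v)" by metis
  have fib: "fibre n c i = V i" if i: "i \<in> {1..k}" for i
  proof (intro equalityI subsetI)
    fix v assume "v \<in> V i"
    moreover from this have "v < n" using U i by blast
    ultimately show "v \<in> fibre n c i"
      using c[of v] disj i unfolding disjoint_family_on_def fibre_def by blast
  qed (use c in \<open>auto simp: fibre_def\<close>)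
  have "satisfies k \<Phi> n E (fibre n c)" using V(3) fib by (simp add: satisfies_def)
  thus "\<exists>c. witness k \<Phi> n E c" using V(1) c by (intro exI[of _ c]) (auto simp: witness_def)
next
  assume "\<exists>c. witness k \<Phi> n E c"
  then obtain c where c: "witness k \<Phi> n E c" ..
  hence "vertex_partition k n (fibre n c)"
    by (auto simp: witness_def vertex_partition_def fibre_def disjoint_family_on_def)
  thus "(n, E) \<in> partition_property k \<Phi>" using c by (auto simp: partition_property_def witness_def)
qed

text \<open>\<open>satisfies\<close> sees only part sizes and class counts, so the edited graph with
  \<open>c\<close> inherits it from \<open>E'\<close> with \<open>c'\<close>.\<close>

lemma dist_to_property_le:
  assumes E: "graph n E" and c: "c ` {..<n} \<subseteq> {1..k}" and w: "witness k \<Phi> n E' c'"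
    and sizes: "\<And>i. i \<in> {1..k} \<Longrightarrow> card (fibre n c i) = card (fibre n c' i)"
  shows "dist_to_property n E (partition_property k \<Phi>) \<le> ereal ((\<Sum>i=1..k. \<Sum>j=1..k.
      \<bar>density_form n E (label_ind c) i j - density_form n E' (label_ind c') i j\<bar>) / 2 / (real n)\<^sup>2)"
proof -
  have E': "graph n E'" using w by (simp add: witness_def)
  obtain E'' where E'': "graph n E''"
    "\<forall>s\<in>label_pairs k. card (edge_class E'' c s) = card (edge_class E' c' s)"
    "graph_dist n E E'' = (\<Sum>i=1..k. \<Sum>j=1..k.
      \<bar>density_form n E (label_ind c) i j - density_form n E' (label_ind c') i j\<bar>) / 2 / (real n)\<^sup>2"
    using ex_edited_graph[OF E E' c sizes] by blast
  have "card (edge_class E'' c {i, j}) = card (edge_class E' c' {i, j})" if "i \<in> {1..k}" "j \<in> {1..k}" for i j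
    using E''(2) that by (auto simp: label_pairs_def)
  hence "satisfies k \<Phi> n E'' (fibre n c) = satisfies k \<Phi> n E' (fibre n c')"
    unfolding satisfies_def edges_between_fibre[OF E''(1)] edges_between_fibre[OF E']
    using sizes by (intro arg_cong2[where f = conj] ball_cong refl) (simp_all only:)
  hence "satisfies k \<Phi> n E'' (fibre n c)" using w by (simp add: witness_def)
  hence "(n, E'') \<in> partition_property k \<Phi>"
    using E'' c unfolding partition_property_witness witness_def by blast
  thus ?thesis unfolding dist_to_property_def E''(3)[symmetric]
    using E''(1) by (intro Inf_lower) auto
qed

section \<open>The estimator\<close>

text \<open>A non-adaptive algorithm as a decision tree: \<open>X\<close> accumulates the pairs
  found to be edges, and \<open>F\<close> is evaluated on them at the end.\<close>

primrec query_all :: "(nat \<times> nat) list \<Rightarrow> (edges \<Rightarrow> ereal) \<Rightarrow> edges \<Rightarrow> decision_tree" where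
  "query_all [] F X = Output (F X)"
| "query_all (q # qs) F X =
    Query (fst q) (snd q) (query_all qs F X) (query_all qs F (insert {fst q, snd q} X))"

definition revealed :: "(nat \<times> nat) list \<Rightarrow> edges \<Rightarrow> edges" where
  "revealed qs E = {e\<in>E. \<exists>q\<in>set qs. e = {fst q, snd q}}"

lemma run_query_all: "run E (query_all qs F X) = F (X \<union> revealed qs E)"
proof (induction qs arbitrary: X)
  case (Cons q qs)
  have "revealed (q # qs) E = (if {fst q, snd q} \<in> E then insert {fst q, snd q} (revealed qs E) else revealed qs E)"
    by (auto simp: revealed_def)
  thus ?case by (auto simp: Cons.IH)
qed (simp add: revealed_def)

lemma num_queries_query_all: "num_queries E (query_all qs F X) = length qs"
  by (induction qs arbitrary: X) auto

lemma adj_revealed: "(u, v) \<in> set qs \<Longrightarrow> adj (revealed qs E) u v = adj E u v"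
  by (auto simp: adj_def revealed_def intro!: bexI[of _ "(u, v)"])

abbreviation weights :: "real \<Rightarrow> edges \<Rightarrow> nat list \<Rightarrow> (nat \<times> real \<times> bool) list \<Rightarrow> nat \<Rightarrow> nat \<Rightarrow> real" where
  "weights \<delta> E \<equiv> tilts (\<delta> / 2) E (\<lambda>_ _. 0)"

text \<open>Sizes and densities are both written as means over a random ordered pair, so that one
  sample serves all of them.\<close>

definition size_stat where
  "size_stat k \<delta> E us as i z = softmax k (weights \<delta> E us as) i (fst z)"

definition density_stat where
  "density_stat k \<delta> E us as i j z =
    adj E (fst z) (snd z) * softmax k (weights \<delta> E us as) i (fst z) * softmax k (weights \<delta> E us as) j (snd z)"

definition sample_mean :: "nat \<Rightarrow> (nat \<Rightarrow> 'a) \<Rightarrow> ('a \<Rightarrow> real) \<Rightarrow> real" where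
  "sample_mean r h \<phi> = (\<Sum>l<r. \<phi> (h l)) / r"

text \<open>The identity for the distance, with sampled densities of the candidates in place of
  densities of partitions. The tolerance 2 \<delta> allows \<delta> for sampling and \<delta> for a
  settled candidate. If no graph on \<open>n\<close> vertices has the property, the infimum is over
  the empty set and equals \<infinity>.\<close>

definition estimate :: "nat \<Rightarrow> partition_description \<Rightarrow> nat \<Rightarrow> real \<Rightarrow> nat list \<Rightarrow> nat \<Rightarrow>
    (nat \<Rightarrow> nat \<times> nat) \<Rightarrow> edges \<Rightarrow> ereal" where
  "estimate k \<Phi> n \<delta> us r h E = Inf {ereal ((\<Sum>i=1..k. \<Sum>j=1..k.
        \<bar>sample_mean r h (density_stat k \<delta> E us as i j) - density_form n E' (label_ind c') i j / (real n)\<^sup>2\<bar>) / 2) | as E' c'.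
     as \<in> advices k (length us) \<and> witness k \<Phi> n E' c' \<and>
     (\<forall>i\<in>{1..k}. \<bar>sample_mean r h (size_stat k \<delta> E us as i) - card (fibre n c' i) / n\<bar> \<le> 2 * \<delta>)}"

definition sample_queries :: "nat list \<Rightarrow> nat \<Rightarrow> (nat \<Rightarrow> nat \<times> nat) \<Rightarrow> (nat \<times> nat) list" where
  "sample_queries us r h =
    concat (map (\<lambda>l. h l # map (Pair (fst (h l))) us @ map (Pair (snd (h l))) us) [0..<r])"

lemma length_sample_queries: "length (sample_queries us r h) = r * (1 + 2 * length us)"
  by (simp add: sample_queries_def length_concat o_def sum_list_triv)

text \<open>A tilt acts vertex by vertex: at \<open>v\<close> it consults only the adjacency of
  \<open>v\<close> to the current sampled vertex, so no other vertex enters the induction.\<close>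

lemma tilts_cong:
  assumes "\<And>u. u \<in> set us \<Longrightarrow> adj E v u = adj E' v u" "\<And>i. \<theta> i v = \<theta>' i v"
  shows "tilts \<eta> E \<theta> us as i v = tilts \<eta> E' \<theta>' us as i v"
  using assms
proof (induction us arbitrary: as \<theta> \<theta>')
  case (Cons u us)
  show ?case
  proof (cases as)
    case (Cons a as')
    obtain j s b where a: "a = (j, s, b)" by (cases a)
    have "tilt \<eta> E u a \<theta> i v = tilt \<eta> E' u a \<theta>' i v" for i
      using Cons.prems by (simp add: tilt_def a)
    thus ?thesis using Cons.IH[of "tilt \<eta> E u a \<theta>" "tilt \<eta> E' u a \<theta>'"] Cons.prems(1) \<open>as = a # as'\<close>
      by simp
  qed (use Cons.prems in simp)
qed simp

text \<open>The estimate depends only on entries that are queried, so the analysis may evaluate it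
  on the whole graph.\<close>

lemma estimate_revealed:
  "estimate k \<Phi> n \<delta> us r h (revealed (sample_queries us r h) E) = estimate k \<Phi> n \<delta> us r h E"
proof -
  define E' where "E' = revealed (sample_queries us r h) E"
  have sm: "softmax k (weights \<delta> E' us as) i v = softmax k (weights \<delta> E us as) i v"
    if l: "l < r" and v: "v = fst (h l) \<or> v = snd (h l)" for l v as i
  proof -
    have "(v, u) \<in> set (sample_queries us r h)" if "u \<in> set us" for u
      using that l v by (auto simp: sample_queries_def)
    hence "adj E' v u = adj E v u" if "u \<in> set us" for u
      using that by (simp add: E'_def adj_revealed)
    hence "weights \<delta> E' us as j v = weights \<delta> E us as j v" for j
      by (intro tilts_cong) auto
    thus ?thesis by (simp add: softmax_def)
  qed
  have "adj E' (fst (h l)) (snd (h l)) = adj E (fst (h l)) (snd (h l))" if "l < r" for l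
    unfolding E'_def using that by (intro adj_revealed) (auto simp: sample_queries_def)
  hence "sample_mean r h (density_stat k \<delta> E' us as i j) = sample_mean r h (density_stat k \<delta> E us as i j)" for as i j
    unfolding sample_mean_def density_stat_def by (intro arg_cong2[where f = divide] sum.cong refl) (auto simp: sm)
  moreover have "sample_mean r h (size_stat k \<delta> E' us as i) = sample_mean r h (size_stat k \<delta> E us as i)" for as i
    unfolding sample_mean_def size_stat_def by (intro arg_cong2[where f = divide] sum.cong refl) (auto simp: sm)
  ultimately show ?thesis unfolding estimate_def E'_def[symmetric] by simp
qed

text \<open>Accuracy is demanded for all advice strings simultaneously, because the estimator
  minimises over them after seeing the sample.\<close>

definition representative :: "nat \<Rightarrow> nat \<Rightarrow> real \<Rightarrow> edges \<Rightarrow> nat list \<Rightarrow> nat \<Rightarrow> (nat \<Rightarrow> nat \<times> nat) \<Rightarrow> bool" where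
  "representative k n \<delta> E us r h \<longleftrightarrow> (\<forall>as\<in>advices k (length us). \<forall>j\<in>{1..k}.
    \<bar>sample_mean r h (size_stat k \<delta> E us as j) - (\<Sum>v<n. softmax k (weights \<delta> E us as) j v) / n\<bar> \<le> \<delta> \<and>
    (\<forall>i\<in>{1..k}. \<bar>sample_mean r h (density_stat k \<delta> E us as i j) -
      density_form n E (softmax k (weights \<delta> E us as)) i j / (real n)\<^sup>2\<bar> \<le> \<delta>))"

lemma softmax_01: "i \<in> {1..k} \<Longrightarrow> softmax k \<theta> i v \<in> {0..1}"
  using softmax_pos[of k \<theta> i v] softmax_le_1[of i k \<theta> v] by simp

text \<open>The settled advice for \<open>c\<close> is an admissible candidate. Each density is off
  by \<delta> from sampling and 4 \<delta> from settling; summing over k^2 pairs and halving gives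
  the error term.\<close>

lemma estimate_le:
  fixes \<delta> :: real
  assumes k: "k \<ge> 1" and n: "n \<ge> 1" and \<delta>: "\<delta> > 0" and E: "graph n E"
    and rep: "representative k n \<delta> E us r h"
    and as: "as \<in> advices k (length us)" "settled k n E \<delta> c (softmax k (weights \<delta> E us as))"
    and w: "witness k \<Phi> n E' c"
  shows "estimate k \<Phi> n \<delta> us r h E \<le> ereal (graph_dist n E E' + 5 / 2 * (real k)\<^sup>2 * \<delta>)"
proof -
  define f where "f = softmax k (weights \<delta> E us as)"
  have N: "(real n)\<^sup>2 > 0" using n by simp
  have E': "graph n E'" "c ` {..<n} \<subseteq> {1..k}" using w by (auto simp: witness_def)
  have sizes: "\<bar>sample_mean r h (size_stat k \<delta> E us as i) - card (fibre n c i) / n\<bar> \<le> 2 * \<delta>"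
    if i: "i \<in> {1..k}" for i
  proof -
    have "\<bar>sample_mean r h (size_stat k \<delta> E us as i) - (\<Sum>v<n. f i v) / n\<bar> \<le> \<delta>"
      using rep as(1) i unfolding representative_def f_def by blast
    moreover have "\<bar>(\<Sum>v<n. f i v) / n - card (fibre n c i) / n\<bar> \<le> \<delta>"
    proof -
      have "\<bar>(\<Sum>v<n. f i v) - card (fibre n c i)\<bar> \<le> \<delta> * n"
        using as(2) i by (simp add: settled_def f_def sum_subtractf sum_label_ind fibre_def)
      thus ?thesis using n by (simp add: field_simps flip: diff_divide_distrib)
    qed
    ultimately show ?thesis by linarith
  qed
  have dens: "\<bar>sample_mean r h (density_stat k \<delta> E us as i j) - density_form n E' (label_ind c) i j / (real n)\<^sup>2\<bar> \<le>
      5 * \<delta> + \<bar>density_form n E (label_ind c) i j - density_form n E' (label_ind c) i j\<bar> / (real n)\<^sup>2"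
    if ij: "i \<in> {1..k}" "j \<in> {1..k}" for i j
  proof -
    have "\<bar>sample_mean r h (density_stat k \<delta> E us as i j) - density_form n E f i j / (real n)\<^sup>2\<bar> \<le> \<delta>"
      using rep as(1) ij unfolding representative_def f_def by blast
    moreover have "\<bar>density_form n E f i j / (real n)\<^sup>2 - density_form n E (label_ind c) i j / (real n)\<^sup>2\<bar> \<le> 4 * \<delta>"
    proof -
      have "\<bar>density_form n E f i j - density_form n E (label_ind c) i j\<bar> \<le> 4 * \<delta> * (real n)\<^sup>2"
        unfolding f_def using as(2) softmax_01 ij \<delta> by (intro settled_density_form_diff_le) auto
      thus ?thesis using N by (simp add: pos_divide_le_eq flip: diff_divide_distrib)
    qed
    moreover have "\<bar>density_form n E (label_ind c) i j / (real n)\<^sup>2 - density_form n E' (label_ind c) i j / (real n)\<^sup>2\<bar> =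
        \<bar>density_form n E (label_ind c) i j - density_form n E' (label_ind c) i j\<bar> / (real n)\<^sup>2"
      by (simp flip: diff_divide_distrib)
    ultimately show ?thesis by linarith
  qed
  have "estimate k \<Phi> n \<delta> us r h E \<le> ereal ((\<Sum>i=1..k. \<Sum>j=1..k.
        \<bar>sample_mean r h (density_stat k \<delta> E us as i j) - density_form n E' (label_ind c) i j / (real n)\<^sup>2\<bar>) / 2)"
    unfolding estimate_def using as(1) w sizes by (intro Inf_lower) blast
  also have "(\<Sum>i=1..k. \<Sum>j=1..k.
        \<bar>sample_mean r h (density_stat k \<delta> E us as i j) - density_form n E' (label_ind c) i j / (real n)\<^sup>2\<bar>) \<le>
      (\<Sum>i=1..k. \<Sum>j=1..k. 5 * \<delta> + \<bar>density_form n E (label_ind c) i j - density_form n E' (label_ind c) i j\<bar> / (real n)\<^sup>2)"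
    by (intro sum_mono dens)
  also have "\<dots> = 5 * (real k)\<^sup>2 * \<delta> + (\<Sum>i=1..k. \<Sum>j=1..k. \<bar>density_form n E (label_ind c) i j - density_form n E' (label_ind c) i j\<bar>) / (real n)\<^sup>2"
    by (simp add: sum.distrib power2_eq_square sum_divide_distrib)
  also have "(5 * (real k)\<^sup>2 * \<delta> + (\<Sum>i=1..k. \<Sum>j=1..k. \<bar>density_form n E (label_ind c) i j - density_form n E' (label_ind c) i j\<bar>) / (real n)\<^sup>2) / 2 \<le>
      graph_dist n E E' + 5 / 2 * (real k)\<^sup>2 * \<delta>"
    using density_form_diff_le_graph_dist[OF E E'] by (simp add: add_divide_distrib)
  finally show ?thesis by (simp add: divide_right_mono)
qed

text \<open>Every candidate is turned into a labelling of \<open>E\<close> with exactly the part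
  sizes of \<open>c'\<close>. Each density changes by 8 k \<delta> for relabelling and 3 \<delta>
  for sampling and rounding, at most 11 k \<delta> together; summing over k^2 pairs and halving
  gives the error term.\<close>

lemma dist_le_estimate:
  fixes \<delta> :: real
  assumes k: "k \<ge> 1" and \<delta>: "\<delta> > 0" "2 \<le> \<delta>\<^sup>2 * n" and E: "graph n E"
    and rep: "representative k n \<delta> E us r h"
  shows "dist_to_property n E (partition_property k \<Phi>) - ereal (11 / 2 * (real k)^3 * \<delta>) \<le> estimate k \<Phi> n \<delta> us r h E"
  unfolding estimate_def
proof (intro Inf_greatest, elim CollectE exE conjE)
  fix x as E' c'
  define \<rho> where "\<rho> i j = sample_mean r h (density_stat k \<delta> E us as i j)" for i j
  define M' where "M' = density_form n E' (label_ind c')"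
  assume x: "x = ereal ((\<Sum>i=1..k. \<Sum>j=1..k.
        \<bar>sample_mean r h (density_stat k \<delta> E us as i j) - density_form n E' (label_ind c') i j / (real n)\<^sup>2\<bar>) / 2)"
    and as: "as \<in> advices k (length us)" and w: "witness k \<Phi> n E' c'"
    and sizes: "\<forall>i\<in>{1..k}. \<bar>sample_mean r h (size_stat k \<delta> E us as i) - card (fibre n c' i) / n\<bar> \<le> 2 * \<delta>"
  define f where "f = softmax k (weights \<delta> E us as)"
  have n: "n > 0" using \<delta> by (cases n) auto
  hence N: "(real n)\<^sup>2 > 0" by simp
  have "\<exists>d. d ` {..<n} \<subseteq> {1..k} \<and>
    (\<forall>i\<in>{1..k}. \<bar>real (card {v\<in>{..<n}. d v = i}) - (\<Sum>v<n. f i v)\<bar> \<le> \<delta> * n) \<and>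
    (\<forall>i\<in>{1..k}. \<forall>j\<in>{1..k}.
      \<bar>density_form n E (label_ind d) i j - density_form n E f i j\<bar> \<le> 2 * \<delta> * (real n)\<^sup>2)"
    unfolding f_def by (intro ex_graph_rounding k \<delta> softmax_pos sum_softmax)
  then obtain d where d: "d ` {..<n} \<subseteq> {1..k}"
    "\<And>i. i \<in> {1..k} \<Longrightarrow> \<bar>real (card (fibre n d i)) - (\<Sum>v<n. f i v)\<bar> \<le> \<delta> * n"
    "\<And>i j. i \<in> {1..k} \<Longrightarrow> j \<in> {1..k} \<Longrightarrow>
      \<bar>density_form n E (label_ind d) i j - density_form n E f i j\<bar> \<le> 2 * \<delta> * (real n)\<^sup>2"
    unfolding fibre_def by blast
  \<comment> \<open>The 4 \<delta> n consists of \<delta> n for sampling, 2 \<delta> n for the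
    tolerance in \<open>estimate\<close> and \<delta> n for rounding.\<close>
  have size: "\<bar>real (card (fibre n d i)) - real (card (fibre n c' i))\<bar> \<le> 4 * \<delta> * n" if i: "i \<in> {1..k}" for i
  proof -
    define \<sigma> where "\<sigma> = sample_mean r h (size_stat k \<delta> E us as i)"
    have "\<bar>\<sigma> - (\<Sum>v<n. f i v) / n\<bar> \<le> \<delta>"
      using rep as i unfolding representative_def f_def \<sigma>_def by blast
    moreover have "\<bar>\<sigma> - card (fibre n c' i) / n\<bar> \<le> 2 * \<delta>" using sizes i by (simp add: \<sigma>_def)
    ultimately have "\<bar>(\<Sum>v<n. f i v) / n - card (fibre n c' i) / n\<bar> \<le> 3 * \<delta>" by linarith
    hence "\<bar>(\<Sum>v<n. f i v) - card (fibre n c' i)\<bar> \<le> 3 * \<delta> * n"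
      using n by (simp add: pos_divide_le_eq flip: diff_divide_distrib)
    thus ?thesis using d(2)[OF i] by linarith
  qed
  have c': "c' ` {..<n} \<subseteq> {1..k}" using w by (simp add: witness_def)
  \<comment> \<open>\<open>dist_to_property_le\<close> needs equal part sizes, so the rounded
    labelling is corrected at a cost of at most its total surplus.\<close>
  have "\<exists>d'. d' ` {..<n} \<subseteq> {1..k} \<and> (\<forall>i\<in>{1..k}. card (fibre n d' i) = card (fibre n c' i)) \<and>
    card {v\<in>{..<n}. d v \<noteq> d' v} \<le> (\<Sum>i=1..k. card (fibre n d i) - card (fibre n c' i))"
    unfolding fibre_def by (intro ex_relabelling d(1) sum_card_fibres c')
  then obtain d' where d': "d' ` {..<n} \<subseteq> {1..k}"
    "\<And>i. i \<in> {1..k} \<Longrightarrow> card (fibre n d' i) = card (fibre n c' i)"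
    "card {v\<in>{..<n}. d v \<noteq> d' v} \<le> (\<Sum>i=1..k. card (fibre n d i) - card (fibre n c' i))"
    by blast
  have "real (card {v\<in>{..<n}. d v \<noteq> d' v}) \<le> (\<Sum>i=1..k. real (card (fibre n d i) - card (fibre n c' i)))"
    using d'(3) by (simp flip: of_nat_sum)
  also have "\<dots> \<le> (\<Sum>i=1..k. 4 * \<delta> * n)"
  proof (intro sum_mono)
    fix i assume "i \<in> {1..k}"
    from size[OF this] show "real (card (fibre n d i) - card (fibre n c' i)) \<le> 4 * \<delta> * n" using \<delta>
      by (cases "card (fibre n c' i) \<le> card (fibre n d i)") (auto simp: of_nat_diff)
  qed
  also have "\<dots> = 4 * real k * \<delta> * n" by simp
  finally have changed: "real (card {v\<in>{..<n}. d v \<noteq> d' v}) \<le> 4 * real k * \<delta> * n" .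
  have scale: "\<bar>a * (real n)\<^sup>2 - b\<bar> = \<bar>a - b / (real n)\<^sup>2\<bar> * (real n)\<^sup>2" for a b :: real
  proof -
    have "a * (real n)\<^sup>2 - b = (a - b / (real n)\<^sup>2) * (real n)\<^sup>2" using N by (simp add: left_diff_distrib)
    thus ?thesis by (simp only: abs_mult) simp
  qed
  have dens: "\<bar>density_form n E (label_ind d') i j - M' i j\<bar> \<le>
      (11 * real k * \<delta> + \<bar>\<rho> i j - M' i j / (real n)\<^sup>2\<bar>) * (real n)\<^sup>2" if ij: "i \<in> {1..k}" "j \<in> {1..k}" for i j
  proof -
    have "\<bar>density_form n E (label_ind d) i j - density_form n E (label_ind d') i j\<bar> \<le>
        2 * real n * real (card {v\<in>{..<n}. d v \<noteq> d' v})"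
      by (rule density_form_relabel_le)
    also have "\<dots> \<le> 2 * real n * (4 * real k * \<delta> * n)" using changed by (intro mult_left_mono) auto
    finally have 1: "\<bar>density_form n E (label_ind d) i j - density_form n E (label_ind d') i j\<bar> \<le> 8 * real k * \<delta> * (real n)\<^sup>2"
      by (simp add: power2_eq_square algebra_simps)
    have 2: "\<bar>density_form n E (label_ind d) i j - density_form n E f i j\<bar> \<le> 2 * \<delta> * (real n)\<^sup>2"
      by (rule d(3)[OF ij])
    have "\<bar>\<rho> i j - density_form n E f i j / (real n)\<^sup>2\<bar> \<le> \<delta>"
      using rep as ij unfolding representative_def f_def \<rho>_def by blast
    hence 3: "\<bar>\<rho> i j * (real n)\<^sup>2 - density_form n E f i j\<bar> \<le> \<delta> * (real n)\<^sup>2"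
      unfolding scale by (intro mult_right_mono) auto
    have 4: "\<bar>\<rho> i j * (real n)\<^sup>2 - M' i j\<bar> = \<bar>\<rho> i j - M' i j / (real n)\<^sup>2\<bar> * (real n)\<^sup>2"
      by (rule scale)
    have "3 * \<delta> * (real n)\<^sup>2 \<le> 3 * real k * \<delta> * (real n)\<^sup>2"
      using k \<delta> by (intro mult_right_mono) auto
    hence "8 * real k * \<delta> * (real n)\<^sup>2 + 3 * \<delta> * (real n)\<^sup>2 \<le> 11 * real k * \<delta> * (real n)\<^sup>2"
      by (simp add: mult_ac)
    moreover have "\<bar>density_form n E (label_ind d') i j - M' i j\<bar> \<le>
        \<bar>density_form n E (label_ind d) i j - density_form n E (label_ind d') i j\<bar> +
        \<bar>density_form n E (label_ind d) i j - density_form n E f i j\<bar> +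
        \<bar>\<rho> i j * (real n)\<^sup>2 - density_form n E f i j\<bar> + \<bar>\<rho> i j * (real n)\<^sup>2 - M' i j\<bar>"
      by linarith
    ultimately show ?thesis using 1 2 3 4 unfolding distrib_right by argo
  qed
  have "dist_to_property n E (partition_property k \<Phi>) \<le> ereal ((\<Sum>i=1..k. \<Sum>j=1..k.
      \<bar>density_form n E (label_ind d') i j - density_form n E' (label_ind c') i j\<bar>) / 2 / (real n)\<^sup>2)"
    by (intro dist_to_property_le E d' w)
  also have "(\<Sum>i=1..k. \<Sum>j=1..k. \<bar>density_form n E (label_ind d') i j - density_form n E' (label_ind c') i j\<bar>) \<le>
      (\<Sum>i=1..k. \<Sum>j=1..k. (11 * real k * \<delta> + \<bar>\<rho> i j - M' i j / (real n)\<^sup>2\<bar>) * (real n)\<^sup>2)"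
    unfolding M'_def[symmetric] by (intro sum_mono dens)
  also have "\<dots> = (11 * (real k)^3 * \<delta> + (\<Sum>i=1..k. \<Sum>j=1..k. \<bar>\<rho> i j - M' i j / (real n)\<^sup>2\<bar>)) * (real n)\<^sup>2"
    by (simp add: sum.distrib power3_eq_cube flip: sum_distrib_right)
  also have "\<dots> / 2 / (real n)\<^sup>2 = (\<Sum>i=1..k. \<Sum>j=1..k. \<bar>\<rho> i j - M' i j / (real n)\<^sup>2\<bar>) / 2 + 11 / 2 * (real k)^3 * \<delta>"
    using n by (simp add: add_divide_distrib)
  finally have "dist_to_property n E (partition_property k \<Phi>) \<le> ereal (
      (\<Sum>i=1..k. \<Sum>j=1..k. \<bar>\<rho> i j - M' i j / (real n)\<^sup>2\<bar>) / 2 + 11 / 2 * (real k)^3 * \<delta>)"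
    by (simp add: divide_right_mono)
  thus "dist_to_property n E (partition_property k \<Phi>) - ereal (11 / 2 * (real k)^3 * \<delta>) \<le> x"
    unfolding x \<rho>_def[symmetric] M'_def[symmetric]
    by (simp add: ereal_minus_le_iff add.commute)
qed

text \<open>Hoeffding's inequality and a union bound over all advice strings and statistics. The
  required number of pairs is linear in \<open>m\<close>, the logarithmic order of the number of
  strings for fixed \<open>k\<close>.\<close>

lemma prob_not_representative_le:
  fixes \<delta> :: real
  assumes k: "k \<ge> 1" and n: "n \<ge> 1" and \<delta>: "\<delta> > 0" and us: "length us = m"
    and r: "r > 0" "6 * real k * m + 24 * (real k)\<^sup>2 \<le> 2 * r * \<delta>\<^sup>2"
  shows "measure_pmf.prob (Pi_pmf {..<r} d (\<lambda>_. pmf_of_set ({..<n} \<times> {..<n})))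
    {h. \<not> representative k n \<delta> E us r h} \<le> 1 / 6"
proof -
  define Z where "Z = pmf_of_set ({..<n} \<times> {..<n})"
  define H where "H = Pi_pmf {..<r} d (\<lambda>_. Z)"
  have ne: "{..<n} \<times> {..<n} \<noteq> {}" "finite ({..<n} \<times> {..<n})" using n by (auto simp: lessThan_empty_iff)
  \<comment> \<open>Labels start at 1, so the index \<open>i = 0\<close> is free to denote the size
    statistic.\<close>
  define \<phi> where "\<phi> = (\<lambda>(as, i, j). if i = 0 then size_stat k \<delta> E us as j else density_stat k \<delta> E us as i j)"
  define J where "J = advices k m \<times> {0..k} \<times> {1..k}"
  define B where "B x = {h. \<bar>sample_mean r h (\<phi> x) - measure_pmf.expectation Z (\<phi> x)\<bar> \<ge> \<delta>}" for x
  have exp_size: "measure_pmf.expectation Z (\<phi> (as, 0, j)) = (\<Sum>v<n. softmax k (weights \<delta> E us as) j v) / n" for as j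
  proof -
    have "measure_pmf.expectation Z (\<phi> (as, 0, j)) =
        (\<Sum>z\<in>{..<n} \<times> {..<n}. softmax k (weights \<delta> E us as) j (fst z)) / (n * n)"
      unfolding Z_def using ne by (subst integral_pmf_of_set) (auto simp: \<phi>_def size_stat_def)
    also have "(\<Sum>z\<in>{..<n} \<times> {..<n}. softmax k (weights \<delta> E us as) j (fst z)) =
        (\<Sum>u<n. \<Sum>v<n. softmax k (weights \<delta> E us as) j u)"
      by (simp only: sum.cartesian_product case_prod_unfold)
    finally show ?thesis using n by (simp flip: sum_distrib_left)
  qed
  have exp_dens: "measure_pmf.expectation Z (\<phi> (as, i, j)) =
      density_form n E (softmax k (weights \<delta> E us as)) i j / (real n)\<^sup>2" if "i \<in> {1..k}" for as i j
    unfolding Z_def using ne that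
    by (subst integral_pmf_of_set)
       (auto simp: \<phi>_def density_stat_def density_form_def sum.cartesian_product case_prod_unfold power2_eq_square)
  have "{h. \<not> representative k n \<delta> E us r h} \<subseteq> (\<Union>x\<in>J. B x)"
  proof (intro subsetI, elim CollectE, rule ccontr)
    fix h assume bad: "\<not> representative k n \<delta> E us r h" and "h \<notin> (\<Union>x\<in>J. B x)"
    hence close: "\<bar>sample_mean r h (\<phi> x) - measure_pmf.expectation Z (\<phi> x)\<bar> \<le> \<delta>" if "x \<in> J" for x
      using that unfolding B_def by (simp add: not_le less_imp_le)
    have "representative k n \<delta> E us r h"
      unfolding representative_def us
    proof (intro ballI conjI)
      fix as j assume as: "as \<in> advices k m" and j: "j \<in> {1..k}"
      show "\<bar>sample_mean r h (size_stat k \<delta> E us as j) - (\<Sum>v<n. softmax k (weights \<delta> E us as) j v) / n\<bar> \<le> \<delta>"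
        using close[of "(as, 0, j)"] as j unfolding exp_size by (simp add: J_def \<phi>_def)
      fix i assume i: "i \<in> {1..k}"
      show "\<bar>sample_mean r h (density_stat k \<delta> E us as i j) -
          density_form n E (softmax k (weights \<delta> E us as)) i j / (real n)\<^sup>2\<bar> \<le> \<delta>"
        using close[of "(as, i, j)"] as i j unfolding exp_dens[OF i] by (simp add: J_def \<phi>_def)
    qed
    thus False using bad by simp
  qed
  hence "measure_pmf.prob H {h. \<not> representative k n \<delta> E us r h} \<le> measure_pmf.prob H (\<Union>x\<in>J. B x)"
    by (intro measure_pmf.finite_measure_mono) auto
  also have "\<dots> \<le> (\<Sum>x\<in>J. measure_pmf.prob H (B x))"
    using finite_advices by (intro measure_pmf.finite_measure_subadditive_finite) (auto simp: J_def)
  also have "\<dots> \<le> (\<Sum>x\<in>J. 2 * exp (- 2 * real r * \<delta>\<^sup>2))"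
  proof (intro sum_mono)
    fix x assume "x \<in> J"
    then obtain as i j where x: "x = (as, i, j)" and ij: "i \<in> {0..k}" "j \<in> {1..k}" by (auto simp: J_def)
    have "\<phi> x z \<in> {0..1}" for z
      using ij softmax_01[of i k "weights \<delta> E us as" "fst z"] softmax_01[of j k "weights \<delta> E us as" "snd z"]
        softmax_01[of j k "weights \<delta> E us as" "fst z"]
      by (auto simp: x \<phi>_def size_stat_def density_stat_def mult_le_one)
    thus "measure_pmf.prob H (B x) \<le> 2 * exp (- 2 * real r * \<delta>\<^sup>2)"
      unfolding H_def B_def sample_mean_def using r \<delta> by (intro Hoeffding_sample_mean) auto
  qed
  also have "\<dots> = real (6 * k) ^ m * ((k + 1) * k) * 2 * exp (- 2 * real r * \<delta>\<^sup>2)"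
    by (simp add: J_def card_cartesian_product card_advices)
  \<comment> \<open>The term \<open>6 * real k * m\<close> in the exponent cancels the number of
    strings; the other term leaves 4 k^2 exp (-24 k^2), which is at most 1/6.\<close>
  also have "\<dots> \<le> exp (6 * real k * m) * (2 * (real k)\<^sup>2) * 2 * exp (- (6 * real k * m + 24 * (real k)\<^sup>2))"
  proof (intro mult_mono)
    have "real (6 * k) \<le> exp (6 * real k)" using exp_ge_add_one_self[of "6 * real k"] by linarith
    hence "real (6 * k) ^ m \<le> exp (6 * real k) ^ m" by (intro power_mono) auto
    thus "real (6 * k) ^ m \<le> exp (6 * real k * m)" by (simp flip: exp_of_nat2_mult)
    show "real ((k + 1) * k) \<le> 2 * (real k)\<^sup>2" using k by (simp add: power2_eq_square)
  qed (use r in auto)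
  also have "\<dots> = 4 * (real k)\<^sup>2 * exp (- (24 * (real k)\<^sup>2))"
    by (simp add: exp_add exp_minus exp_diff field_simps)
  also have "\<dots> \<le> 4 * (real k)\<^sup>2 * (1 / (24 * (real k)\<^sup>2))"
  proof (intro mult_left_mono)
    have "24 * (real k)\<^sup>2 \<le> exp (24 * (real k)\<^sup>2)"
      using exp_ge_add_one_self[of "24 * (real k)\<^sup>2"] by linarith
    thus "exp (- (24 * (real k)\<^sup>2)) \<le> 1 / (24 * (real k)\<^sup>2)"
      using k by (simp add: exp_minus field_simps)
  qed auto
  also have "\<dots> = 1 / 6" using k by simp
  finally show ?thesis by (simp add: H_def Z_def)
qed

section \<open>The algorithm\<close>

text \<open>The cube of \<open>k\<close> absorbs the error of \<open>dist_le_estimate\<close>; the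
  factor 20 also brings the error of \<open>estimate_le\<close> below \<epsilon>/2.\<close>

definition precision :: "nat \<Rightarrow> real \<Rightarrow> real" where
  "precision k \<epsilon> = \<epsilon> / (20 * real k ^ 3)"

text \<open>The initial potential n ln k is at most k n, so dividing by \<delta>^3 n / 4 gives at
  most 4 k / \<delta>^3. Six times this many columns bring the failure probability down to
  1/6.\<close>

definition num_columns :: "nat \<Rightarrow> real \<Rightarrow> nat" where
  "num_columns k \<delta> = nat \<lceil>24 * real k / \<delta> ^ 3\<rceil>"

definition num_pairs :: "nat \<Rightarrow> real \<Rightarrow> nat" where
  "num_pairs k \<delta> = nat \<lceil>(6 * real k * num_columns k \<delta> + 24 * (real k)\<^sup>2) / \<delta>\<^sup>2\<rceil>"

definition sampler :: "nat \<Rightarrow> nat \<Rightarrow> real \<Rightarrow> (nat list \<times> (nat \<Rightarrow> nat \<times> nat)) pmf" where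
  "sampler k n \<delta> = pair_pmf (replicate_pmf (num_columns k \<delta>) (pmf_of_set {..<n}))
     (Pi_pmf {..<num_pairs k \<delta>} (0, 0) (\<lambda>_. pmf_of_set ({..<n} \<times> {..<n})))"

text \<open>The estimate is only sound for \<open>n \<ge> 2 / \<delta>\<^sup>2\<close>, because of the rounding error.\<close>

definition partition_algorithm :: "nat \<Rightarrow> partition_description \<Rightarrow> query_algorithm" where
  "partition_algorithm k \<Phi> n \<epsilon> = (let \<delta> = precision k \<epsilon>; r = num_pairs k \<delta> in
     if \<delta>\<^sup>2 * n < 2
     then return_pmf (query_all (List.product [0..<n] [0..<n])
       (\<lambda>E. dist_to_property n E (partition_property k \<Phi>)) {})
     else map_pmf (\<lambda>(us, h). query_all (sample_queries us r h) (estimate k \<Phi> n \<delta> us r h) {})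
       (sampler k n \<delta>))"

text \<open>Each of two bad events has probability at most 1/6: that no advice settles for
  \<open>c\<close>, which concerns the columns alone, and that the pairs are not representative,
  bounded conditionally on the columns.\<close>

lemma prob_sampler_good_ge:
  assumes k: "k \<ge> 1" and n: "n \<ge> 1" and \<delta>: "0 < \<delta>" "\<delta> \<le> 1" and c: "c ` {..<n} \<subseteq> {1..k}"
  shows "measure_pmf.prob (sampler k n \<delta>) {z. representative k n \<delta> E (fst z) (num_pairs k \<delta>) (snd z) \<and>
    (\<exists>as\<in>advices k (length (fst z)). settled k n E \<delta> c (softmax k (weights \<delta> E (fst z) as)))} \<ge> 2 / 3"
proof -
  define m where "m = num_columns k \<delta>"
  define r where "r = num_pairs k \<delta>"
  define p where "p = replicate_pmf m (pmf_of_set {..<n})"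
  define q where "q = Pi_pmf {..<r} (0, 0) (\<lambda>_. pmf_of_set ({..<n} \<times> {..<n}))"
  have S: "sampler k n \<delta> = pair_pmf p q" by (simp add: sampler_def p_def q_def m_def r_def)
  define A where "A us \<longleftrightarrow> (\<exists>as\<in>advices k m. settled k n E \<delta> c (softmax k (weights \<delta> E us as)))" for us
  have m: "24 * real k / \<delta> ^ 3 \<le> real m" unfolding m_def num_columns_def by linarith
  moreover have "24 * real k / \<delta> ^ 3 > 0" using k \<delta> by simp
  ultimately have m0: "real m > 0" by linarith
  have "real m * measure_pmf.prob p {us. \<not> A us} \<le> potential k n c (\<lambda>_ _. 0) / (\<delta>^3 / 4 * n)"
    unfolding p_def A_def by (rule prob_not_settled_le[OF k \<delta> n c])
  also have "\<dots> = 4 * ln k / \<delta> ^ 3" using n \<delta> by (simp add: potential_0[OF k])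
  also have "\<dots> \<le> 4 * real k / \<delta> ^ 3"
    using ln_le_minus_one[of "real k"] k \<delta> by (intro divide_right_mono) auto
  also have "\<dots> \<le> real m * (1 / 6)" using m by simp
  finally have bad1: "measure_pmf.prob p {us. \<not> A us} \<le> 1 / 6" using m0 by (simp only: mult_le_cancel_left_pos)
  have "(6 * real k * m + 24 * (real k)\<^sup>2) / \<delta>\<^sup>2 \<le> real r"
    unfolding r_def num_pairs_def m_def[symmetric] by linarith
  moreover have "(6 * real k * m + 24 * (real k)\<^sup>2) / \<delta>\<^sup>2 > 0" using k \<delta> by (simp add: add_nonneg_pos)
  ultimately have r: "6 * real k * m + 24 * (real k)\<^sup>2 \<le> real r * \<delta>\<^sup>2" "r > 0"
    using \<delta> by (simp add: pos_divide_le_eq, linarith)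
  have "real r * \<delta>\<^sup>2 \<ge> 0" by simp
  hence r2: "6 * real k * m + 24 * (real k)\<^sup>2 \<le> 2 * real r * \<delta>\<^sup>2"
    using r(1) unfolding mult.assoc[of 2] by linarith
  have bad2: "measure_pmf.prob (pair_pmf p q) {z. \<not> representative k n \<delta> E (fst z) r (snd z)} \<le> 1 / 6"
  proof (rule prob_pair_pmf_le)
    fix us assume "us \<in> set_pmf p"
    hence "length us = m" by (simp add: p_def set_replicate_pmf)
    thus "measure_pmf.prob q {h. \<not> representative k n \<delta> E us r h} \<le> 1 / 6"
      unfolding q_def using k n \<delta> r(2) r2 by (intro prob_not_representative_le) auto
  qed
  have bad1': "measure_pmf.prob (pair_pmf p q) {z. \<not> A (fst z)} \<le> 1 / 6"
  proof -
    have "measure_pmf.prob (pair_pmf p q) {z. \<not> A (fst z)} = measure_pmf.prob (map_pmf fst (pair_pmf p q)) {us. \<not> A us}"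
      by (simp only: measure_map_pmf vimage_Collect_eq)
    also have "\<dots> \<le> 1 / 6" unfolding map_fst_pair_pmf by (rule bad1)
    finally show ?thesis .
  qed
  define G where "G = {z. representative k n \<delta> E (fst z) r (snd z) \<and>
    (\<exists>as\<in>advices k (length (fst z)). settled k n E \<delta> c (softmax k (weights \<delta> E (fst z) as)))}"
  have "measure_pmf.prob (pair_pmf p q) (- G) \<le> measure_pmf.prob (pair_pmf p q)
      ({z. \<not> A (fst z)} \<union> {z. \<not> representative k n \<delta> E (fst z) r (snd z)})"
  proof (intro measure_pmf.finite_measure_mono_AE)
    have "length (fst z) = m" if "z \<in> set_pmf (pair_pmf p q)" for z
    proof -
      have "fst z \<in> set_pmf p" using that by (simp add: set_pair_pmf mem_Times_iff)
      thus ?thesis by (simp add: p_def set_replicate_pmf)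
    qed
    thus "AE z in pair_pmf p q. z \<in> - G \<longrightarrow>
        z \<in> {z. \<not> A (fst z)} \<union> {z. \<not> representative k n \<delta> E (fst z) r (snd z)}"
      by (auto simp: AE_measure_pmf_iff G_def A_def)
  qed auto
  also have "\<dots> \<le> 1 / 6 + 1 / 6"
    by (rule order_trans[OF measure_Un_le add_mono[OF bad1' bad2]]) auto
  finally have "measure_pmf.prob (pair_pmf p q) (- G) \<le> 1 / 3" by simp
  moreover have "measure_pmf.prob (pair_pmf p q) (- G) = 1 - measure_pmf.prob (pair_pmf p q) G"
    using measure_pmf.prob_compl[of G "pair_pmf p q"] by (simp add: Compl_eq_Diff_UNIV)
  ultimately show ?thesis unfolding S G_def r_def by simp
qed

section \<open>Correctness of the algorithm\<close>

lemma revealed_all: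
  assumes "graph n E"
  shows "revealed (List.product [0..<n] [0..<n]) E = E"
proof -
  have "\<exists>q\<in>set (List.product [0..<n] [0..<n]). e = {fst q, snd q}" if "e \<in> E" for e
  proof -
    have "e \<in> complete_edges n" using assms that unfolding graph_def by blast
    then obtain u v where "e = {u, v}" "u < n" "v < n" by blast
    thus ?thesis by (intro bexI[of _ "(u, v)"]) auto
  qed
  thus ?thesis by (auto simp: revealed_def)
qed

lemma precision_bounds:
  assumes "k \<ge> 1" "0 < \<epsilon>" "\<epsilon> < 1"
  shows "0 < precision k \<epsilon>" "precision k \<epsilon> \<le> 1"
    "11 / 2 * real k ^ 3 * precision k \<epsilon> \<le> \<epsilon>" "5 / 2 * (real k)\<^sup>2 * precision k \<epsilon> \<le> \<epsilon> / 2"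
proof -
  have k3: "real k ^ 3 \<ge> 1" using assms by (intro one_le_power) auto
  have k23: "(real k)\<^sup>2 \<le> real k ^ 3" using assms by (intro power_increasing) auto
  show pos: "0 < precision k \<epsilon>" using assms by (simp add: precision_def)
  have eq: "real k ^ 3 * precision k \<epsilon> = \<epsilon> / 20" using assms by (simp add: precision_def)
  have "1 * precision k \<epsilon> \<le> real k ^ 3 * precision k \<epsilon>" using k3 pos by (intro mult_right_mono) auto
  thus "precision k \<epsilon> \<le> 1" using eq assms by simp
  show "11 / 2 * real k ^ 3 * precision k \<epsilon> \<le> \<epsilon>" using eq assms by simp
  have "(real k)\<^sup>2 * precision k \<epsilon> \<le> real k ^ 3 * precision k \<epsilon>" using k23 pos by (intro mult_right_mono) auto
  hence "5 / 2 * ((real k)\<^sup>2 * precision k \<epsilon>) \<le> \<epsilon> / 2" using eq assms by linarith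
  thus "5 / 2 * (real k)\<^sup>2 * precision k \<epsilon> \<le> \<epsilon> / 2" by (simp only: mult.assoc)
qed

lemma graph_dist_nonneg: "graph_dist n E E' \<ge> 0"
  by (simp add: graph_dist_def)

lemma distance_approximation_partition_algorithm:
  assumes k: "k \<ge> 1"
  shows "distance_approximation (partition_property k \<Phi>) (partition_algorithm k \<Phi>)"
  unfolding distance_approximation_def
proof (intro allI impI, elim conjE)
  fix n E and \<epsilon> :: real
  assume n: "n \<ge> 1" and E: "graph n E" and \<epsilon>: "0 < \<epsilon>" "\<epsilon> < 1"
  define \<delta> where "\<delta> = precision k \<epsilon>"
  define r where "r = num_pairs k \<delta>"
  define \<Delta> where "\<Delta> = dist_to_property n E (partition_property k \<Phi>)"
  note \<delta> = precision_bounds[OF k \<epsilon>, folded \<delta>_def]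
  define T where "T = {t. \<Delta> - ereal \<epsilon> \<le> run E t \<and> run E t \<le> \<Delta> + ereal \<epsilon>}"
  have \<Delta>: "\<Delta> \<ge> 0" unfolding \<Delta>_def dist_to_property_def
    by (intro Inf_greatest) (auto simp: graph_dist_nonneg)
  have exact: "\<Delta> - ereal \<epsilon> \<le> \<Delta> \<and> \<Delta> \<le> \<Delta> + ereal \<epsilon>"
    using \<epsilon> \<Delta> by (cases \<Delta>) auto
  have "measure_pmf.prob (partition_algorithm k \<Phi> n \<epsilon>) T \<ge> 2 / 3"
  proof (cases "\<delta>\<^sup>2 * n < 2")
    case True
    have "query_all (List.product [0..<n] [0..<n]) (\<lambda>E. dist_to_property n E (partition_property k \<Phi>)) {} \<in> T"
      using exact by (simp add: T_def run_query_all revealed_all[OF E] \<Delta>_def)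
    thus ?thesis using True
      by (simp add: partition_algorithm_def Let_def flip: \<delta>_def)
  next
    case False
    define G where "G = {z. \<Delta> - ereal \<epsilon> \<le> estimate k \<Phi> n \<delta> (fst z) r (snd z) E \<and>
      estimate k \<Phi> n \<delta> (fst z) r (snd z) E \<le> \<Delta> + ereal \<epsilon>}"
    have "partition_algorithm k \<Phi> n \<epsilon> =
        map_pmf (\<lambda>(us, h). query_all (sample_queries us r h) (estimate k \<Phi> n \<delta> us r h) {}) (sampler k n \<delta>)"
      using False by (simp add: partition_algorithm_def Let_def flip: \<delta>_def r_def)
    moreover have "(\<lambda>(us, h). query_all (sample_queries us r h) (estimate k \<Phi> n \<delta> us r h) {}) -` T = G"
      by (auto simp: T_def G_def run_query_all estimate_revealed)
    ultimately have alg: "measure_pmf.prob (partition_algorithm k \<Phi> n \<epsilon>) T = measure_pmf.prob (sampler k n \<delta>) G"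
      by simp
    show ?thesis
    proof (cases "\<exists>E'. (n, E') \<in> partition_property k \<Phi>")
      case False
      \<comment> \<open>Both infima are over the empty set, so the output \<infinity> is correct for
        every outcome of the sampling.\<close>
      hence "\<Delta> = \<infinity>" by (simp add: \<Delta>_def dist_to_property_def top_ereal_def)
      moreover have "estimate k \<Phi> n \<delta> us r h E = \<infinity>" for us h
        using False by (simp add: estimate_def partition_property_witness top_ereal_def)
      ultimately have "G = UNIV" by (simp add: G_def)
      thus ?thesis by (simp add: alg)
    next
      case True
      then obtain E1 where "(n, E1) \<in> partition_property k \<Phi>" ..
      hence "\<Delta> \<le> ereal (graph_dist n E E1)" unfolding \<Delta>_def dist_to_property_def
        by (intro Inf_lower) (auto simp: partition_property_def)
      then obtain D where D: "\<Delta> = ereal D" using \<Delta> by (cases \<Delta>) auto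
      \<comment> \<open>A graph within \<epsilon>/2 of the infimum suffices, since
        \<open>estimate_le\<close> loses at most another \<epsilon>/2. Its labelling
        \<open>c\<close> is fixed before sampling, as \<open>prob_sampler_good_ge\<close>
        requires.\<close>
      have "\<Delta> < ereal (D + \<epsilon> / 2)" using D \<epsilon> by simp
      then obtain E' where E': "(n, E') \<in> partition_property k \<Phi>" "graph_dist n E E' < D + \<epsilon> / 2"
        unfolding \<Delta>_def dist_to_property_def Inf_less_iff by auto
      then obtain c where w: "witness k \<Phi> n E' c" unfolding partition_property_witness by blast
      hence c: "c ` {..<n} \<subseteq> {1..k}" by (simp add: witness_def)
      have "{z. representative k n \<delta> E (fst z) r (snd z) \<and>
          (\<exists>as\<in>advices k (length (fst z)). settled k n E \<delta> c (softmax k (weights \<delta> E (fst z) as)))} \<subseteq> G"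
      proof (intro subsetI, elim CollectE conjE bexE)
        fix z as
        assume rep: "representative k n \<delta> E (fst z) r (snd z)"
          and as: "as \<in> advices k (length (fst z))" "settled k n E \<delta> c (softmax k (weights \<delta> E (fst z) as))"
        define R where "R = estimate k \<Phi> n \<delta> (fst z) r (snd z) E"
        have "R \<le> ereal (graph_dist n E E' + 5 / 2 * (real k)\<^sup>2 * \<delta>)"
          unfolding R_def by (rule estimate_le[OF k n \<delta>(1) E rep as w])
        also have "\<dots> \<le> ereal (D + \<epsilon>)" 
          unfolding ereal_less_eq(3) using E'(2) \<delta>(4) by linarith
        finally have up: "R \<le> ereal (D + \<epsilon>)" .
        have "\<Delta> - ereal (11 / 2 * real k ^ 3 * \<delta>) \<le> R"
          unfolding R_def \<Delta>_def using False by (intro dist_le_estimate k \<delta>(1) E rep) simp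
        moreover have "\<Delta> - ereal \<epsilon> \<le> \<Delta> - ereal (11 / 2 * real k ^ 3 * \<delta>)"
          using \<delta>(3) by (simp add: D)
        ultimately have "\<Delta> - ereal \<epsilon> \<le> R" by (rule order_trans[rotated])
        thus "z \<in> G" using up by (simp add: G_def D flip: R_def)
      qed
      hence "measure_pmf.prob (sampler k n \<delta>) {z. representative k n \<delta> E (fst z) r (snd z) \<and>
          (\<exists>as\<in>advices k (length (fst z)). settled k n E \<delta> c (softmax k (weights \<delta> E (fst z) as)))} \<le>
          measure_pmf.prob (sampler k n \<delta>) G"
        by (intro measure_pmf.finite_measure_mono) auto
      thus ?thesis
        using prob_sampler_good_ge[OF k n \<delta>(1,2) c, of E] unfolding alg r_def by linarith
    qed
  qed
  thus "2 / 3 \<le> measure_pmf.prob (partition_algorithm k \<Phi> n \<epsilon>)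
      {t. dist_to_property n E (partition_property k \<Phi>) - ereal \<epsilon> \<le> run E t \<and>
          run E t \<le> dist_to_property n E (partition_property k \<Phi>) + ereal \<epsilon>}"
    by (simp add: T_def \<Delta>_def)
qed

section \<open>Query complexity\<close>

definition query_bound :: real where
  "query_bound = 10 ^ 16"

lemma nat_ceiling_le: "x \<ge> 1 \<Longrightarrow> real (nat \<lceil>x\<rceil>) \<le> 2 * x"
  by linarith

text \<open>With y = 1/\<epsilon>, there are O(k^10 y^3) columns \<open>m\<close> and O(k^17 y^5)
  pairs \<open>r\<close>, hence O(k^27 y^8) queries \<open>r * (1 + 2 * m)\<close>. Reading the
  whole matrix when n < 2 / \<delta>^2 costs only O(k^12 y^4).\<close>

lemma num_queries_partition_algorithm_le:
  assumes k: "k \<ge> 1" and \<epsilon>: "0 < \<epsilon>" "\<epsilon> < 1" and t: "t \<in> set_pmf (partition_algorithm k \<Phi> n \<epsilon>)"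
  shows "real (num_queries E t) \<le> query_bound * real k ^ 27 * (1 / \<epsilon>) ^ 8"
proof -
  define \<delta> where "\<delta> = precision k \<epsilon>"
  define x where "x = real k"
  define y where "y = 1 / \<epsilon>"
  define a where "a = 20 * x ^ 3 * y"
  have x: "x \<ge> 1" using k by (simp add: x_def)
  have y: "y \<ge> 1" using \<epsilon> by (simp add: y_def)
  have xp: "x ^ i \<ge> 1" and yp: "y ^ i \<ge> 1" for i using x y by (auto intro: one_le_power)
  have \<delta>: "\<delta> > 0" "1 / \<delta> = a"
    using precision_bounds(1)[OF k \<epsilon>] by (auto simp: \<delta>_def precision_def a_def x_def y_def)
  have \<delta>p: "z / \<delta> ^ i = z * a ^ i" for z :: real and i
    by (simp add: power_one_over flip: \<delta>(2))
  have mono: "x ^ i * y ^ j \<le> x ^ i' * y ^ j'" if "i \<le> i'" "j \<le> j'" for i i' j j'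
    using that x y by (intro mult_mono power_increasing) auto
  have ge_1: "1 \<le> x ^ i * y ^ j" for i j using mono[of 0 i 0 j] by simp
  show ?thesis
  proof (cases "\<delta>\<^sup>2 * n < 2")
    case True
    have "real n < 2 * a\<^sup>2"
      using True \<delta>(1) by (simp add: pos_less_divide_eq mult.commute flip: \<delta>p)
    hence "(real n)\<^sup>2 \<le> (2 * a\<^sup>2)\<^sup>2" by (intro power_mono) auto
    also have "\<dots> = 640000 * (x ^ 12 * y ^ 4)" by (simp add: a_def power_mult_distrib flip: power_mult)
    also have "\<dots> \<le> query_bound * (x ^ 27 * y ^ 8)"
      unfolding query_bound_def using xp yp by (intro mult_mono mono) auto
    finally have "(real n)\<^sup>2 \<le> query_bound * (x ^ 27 * y ^ 8)" .
    moreover have "num_queries E t = n ^ 2"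
      using t True by (simp add: partition_algorithm_def Let_def num_queries_query_all power2_eq_square flip: \<delta>_def)
    ultimately show ?thesis by (simp add: x_def y_def mult.assoc)
  next
    case False
    define m where "m = num_columns k \<delta>"
    define r where "r = num_pairs k \<delta>"
    have "24 * x / \<delta> ^ 3 = 192000 * (x ^ 10 * y ^ 3)"
      unfolding \<delta>p by (simp add: a_def power_mult_distrib flip: power_mult power_Suc)
    moreover have "1 \<le> 192000 * (x ^ 10 * y ^ 3)"
      using ge_1[of 10 3] by simp
    ultimately have m: "real m \<le> 384000 * (x ^ 10 * y ^ 3)"
      using nat_ceiling_le[of "24 * x / \<delta> ^ 3"] by (simp add: m_def num_columns_def x_def)
    have "(6 * x * m + 24 * x\<^sup>2) / \<delta>\<^sup>2 = (6 * x * m + 24 * x\<^sup>2) * (400 * (x ^ 6 * y\<^sup>2))"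
      unfolding \<delta>p by (simp add: a_def power_mult_distrib flip: power_mult)
    also have "\<dots> \<le> (6 * x * (384000 * (x ^ 10 * y ^ 3)) + 24 * (x ^ 11 * y ^ 3)) * (400 * (x ^ 6 * y\<^sup>2))"
    proof (intro mult_right_mono add_mono mult_left_mono m)
      show "x\<^sup>2 \<le> x ^ 11 * y ^ 3" using mono[of 2 11 0 3] by simp
    qed (use x y in auto)
    also have "\<dots> = 921609600 * (x ^ 17 * y ^ 5)"
      by (simp add: algebra_simps flip: power_Suc power_add)
    finally have r_le: "(6 * x * m + 24 * x\<^sup>2) / \<delta>\<^sup>2 \<le> 921609600 * (x ^ 17 * y ^ 5)" .
    have "real r \<le> 2 * (921609600 * (x ^ 17 * y ^ 5))"
    proof -
      have "1 \<le> 921609600 * (x ^ 17 * y ^ 5)" using ge_1[of 17 5] by simp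
      moreover have "real r \<le> real (nat \<lceil>921609600 * (x ^ 17 * y ^ 5)\<rceil>)"
        using r_le unfolding r_def num_pairs_def m_def x_def by (intro of_nat_mono nat_mono ceiling_mono) simp
      ultimately show ?thesis using nat_ceiling_le by (meson order_trans)
    qed
    moreover have "1 + 2 * real m \<le> 768001 * (x ^ 10 * y ^ 3)"
      using m ge_1[of 10 3] by simp
    ultimately have "real r * (1 + 2 * real m) \<le> 2 * (921609600 * (x ^ 17 * y ^ 5)) * (768001 * (x ^ 10 * y ^ 3))"
      using x y by (intro mult_mono) auto
    also have "\<dots> = (2 * 921609600 * 768001) * (x ^ 27 * y ^ 8)"
      by (simp add: algebra_simps flip: power_add)
    also have "\<dots> \<le> 10 ^ 16 * (x ^ 27 * y ^ 8)"
      using x y by (intro mult_right_mono) auto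
    finally have "real r * (1 + 2 * real m) \<le> 10 ^ 16 * (x ^ 27 * y ^ 8)" .
    moreover have "real (num_queries E t) = real r * (1 + 2 * real m)"
    proof -
      obtain us h where "t = query_all (sample_queries us r h) (estimate k \<Phi> n \<delta> us r h) {}"
        "us \<in> set_pmf (replicate_pmf m (pmf_of_set {..<n}))"
        using t False by (auto simp: partition_algorithm_def Let_def sampler_def m_def r_def simp flip: \<delta>_def)
      thus ?thesis by (simp add: num_queries_query_all length_sample_queries set_replicate_pmf distrib_left)
    qed
    ultimately show ?thesis by (simp only: x_def y_def mult.assoc query_bound_def)
  qed
qed

theorem theoremB2:
  "\<exists>p :: real poly poly. \<forall>k\<ge>1. \<forall>\<Phi>. valid_description k \<Phi> \<longrightarrow>
     (\<exists>A. distance_approximation (partition_property k \<Phi>) A \<and>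
          query_complexity_le A (\<lambda>\<epsilon>. poly2 p (real k) (1 / \<epsilon>)))"
proof -
  \<comment> \<open>The inner variable stands for \<open>k\<close> and the outer one for
    1/\<epsilon>; the same monomial serves every \<open>k\<close> and \<open>\<Phi>\<close>.\<close>
  define p where "p = monom (monom query_bound 27) 8"
  have p: "poly2 p x y = query_bound * x ^ 27 * y ^ 8" for x y
    by (simp add: poly2_def p_def poly_monom poly_power)
  have "distance_approximation (partition_property k \<Phi>) (partition_algorithm k \<Phi>) \<and>
      query_complexity_le (partition_algorithm k \<Phi>) (\<lambda>\<epsilon>. poly2 p (real k) (1 / \<epsilon>))" if "k \<ge> 1" for k \<Phi>
    unfolding query_complexity_le_def p
    using distance_approximation_partition_algorithm[OF that] num_queries_partition_algorithm_le[OF that]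
    by blast
  thus ?thesis by blast
qed

end
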